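(* Let $b$ be a prime. For all $m,n\in\mathbb{N}$ with $n>2m$, let $P_H^{\mathrm{sym},n}$ be the two-dimensional truncated symmetrized Hammersley point set in base $b$ consisting of $N=b^{m+2}$ points. Then the minimum Dick weight of $P_H^{\mathrm{sym},n}$ is larger than $2m+1$: $$\rho_2(P_H^{\mathrm{sym},n})>2m+1.$$ Consequently, for every $p\in[1,\infty)$ there is a constant $C_p>0$ depending only on $p$ (for the fixed base $b$; in particular independent of $m$ and $n$) such that, for all such $m,n$, $$L_p(P_H^{\mathrm{sym},n})\le C_p\frac{\sqrt{m+2}}{b^{m+2}}=C_p\frac{\sqrt{\log_bN}}{N}.$$
   Context: $\mathbb{N}$ is the set of positive integers, $\mathbb{N}_0=\mathbb{N}\cup\{0\}$, $\mathbb{Z}_b=\{0,1,\dots,b-1\}$ with arithmetic modulo $b$, and $\oplus$ denotes addition modulo $b$. For $m\in\mathbb{N}$ and $n\ge m+2$, the truncated symmetrized Hammersley point set is (counted with multiplicity) $$P_H^{\mathrm{sym},n}=\{(x^n_{\boldsymbol a},y^n_{\boldsymbol a}):\boldsymbol a=(a_1,\dots,a_{m+2})\in\{0,1,\dots,b-1\}^{m+2}\},$$ $$x^n_{\boldsymbol a}=\frac{a_1\oplus a_{m+1}}{b}+\dots+\frac{a_m\oplus a_{m+1}}{b^m}+\frac{a_{m+1}}{b^{m+1}}+\dots+\frac{a_{m+1}}{b^n},$$ $$y^n_{\boldsymbol a}=\frac{a_m\oplus a_{m+2}}{b}+\dots+\frac{a_1\oplus a_{m+2}}{b^m}+\frac{a_{m+2}}{b^{m+1}}+\dots+\frac{a_{m+2}}{b^n}.$$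 It is a digital net over $\mathbb{Z}_b$ with the following $n\times(m+2)$ generating matrices $C_1,C_2$ (extended by zero rows below row $n$), where $\boldsymbol{u}_i$ is the $i$-th unit row vector in $\mathbb{Z}_b^{m+2}$: the $l$-th row of $C_1$ is $\boldsymbol u_l+\boldsymbol u_{m+1}$ for $1\le l\le m$ and $\boldsymbol u_{m+1}$ for $m<l\le n$; the $l$-th row of $C_2$ is $\boldsymbol u_{m+1-l}+\boldsymbol u_{m+2}$ for $1\le l\le m$ and $\boldsymbol u_{m+2}$ for $m<l\le n$. The dual net $P^\perp$ of a two-dimensional digital net $P$ with generating matrices $C_1,C_2$ having $M$ columns is the set of $(k_1,k_2)\in\mathbb{N}_0^2$ with $\vec k_1C_1\oplus\vec k_2C_2=(0,\dots,0)\in\mathbb{Z}_b^M$, where $\vec k_j=(\kappa_{j,0},\kappa_{j,1},\dots)$ is the row vector of $b$-adic digits of $k_j=\kappa_{j,0}+\kappa_{j,1}b+\cdots$. Dick weight: for $k\in\mathbb{N}$ write $k=\kappa_1b^{a_1-1}+\dots+\kappa_vb^{a_v-1}$ with $\kappa_i\in\{1,\dots,b-1\}$ and $a_1>\dots>a_v>0$; $\mu_2(k)=a_1+a_2$ if $v\ge2$, $\mu_2(k)=a_1$ if $v=1$, and $\mu_2(0)=0$. For $\boldsymbol k=(k_1,k_2)$, $\mu_2(\boldsymbol k)=\mu_2(k_1)+\mu_2(k_2)$. The minimum Dick weight is $\rho_2(P)=\min_{\boldsymbol k\in P^\perp\setminus\{(0,0)\}}\mu_2(\boldsymbol k)$.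 $L_p$ discrepancy: for a finite point set $P\subset[0,1]^2$ (with multiplicity), $\Delta(\boldsymbol t;P)=\frac1{|P|}\sum_{\boldsymbol x\in P}1_{[\boldsymbol0,\boldsymbol t)}(\boldsymbol x)-t_1t_2$ with $[\boldsymbol0,\boldsymbol t)=[0,t_1)\times[0,t_2)$, and $L_p(P)=\left(\int_{[0,1]^2}|\Delta(\boldsymbol t;P)|^p\,\mathrm{d}\boldsymbol t\right)^{1/p}$. *)

theory Defs
  imports "HOL-Analysis.Analysis" "HOL-Library.Multiset" "HOL-Library.FuncSet"
    "HOL-Computational_Algebra.Primes"
begin

text \<open>
  Elements of \<open>\<int>\<^sub>b\<close> are represented by the natural numbers below \<open>b\<close>.  Vectors and matrices
  over \<open>\<int>\<^sub>b\<close> are functions on indices starting at 1; for a matrix \<open>C\<close>, the entry in row \<open>l\<close> and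
  column \<open>i\<close> is \<open>C l i\<close>.  There are infinitely many rows, almost all of which are zero in the
  case considered here.
\<close>

definition Zb_vectors :: "nat \<Rightarrow> nat \<Rightarrow> (nat \<Rightarrow> nat) set" where
  "Zb_vectors b M = {1..M} \<rightarrow>\<^sub>E {0..<b}"

definition bdigit :: "nat \<Rightarrow> nat \<Rightarrow> nat \<Rightarrow> nat" where
  "bdigit b k i = (k div b ^ i) mod b"

text \<open>
  The exponents \<open>a\<^sub>1 > \<dots> > a\<^sub>v > 0\<close> in \<open>k = \<kappa>\<^sub>1 b\<^bsup>a\<^sub>1 - 1\<^esup> + \<dots> + \<kappa>\<^sub>v b\<^bsup>a\<^sub>v - 1\<^esup>\<close> with nonzero
  digits \<open>\<kappa>\<^sub>i\<close>.  This set is finite for \<open>b \<ge> 2\<close>.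
\<close>

definition digit_positions :: "nat \<Rightarrow> nat \<Rightarrow> nat set" where
  "digit_positions b k = {a. 1 \<le> a \<and> bdigit b k (a - 1) \<noteq> 0}"

definition dick_weight :: "nat \<Rightarrow> nat \<Rightarrow> nat" where
  "dick_weight b k =
    (let A = digit_positions b k; A' = A - {Max A}
     in if A = {} then 0 else if A' = {} then Max A else Max A + Max A')"

definition dick_weight2 :: "nat \<Rightarrow> nat \<times> nat \<Rightarrow> nat" where
  "dick_weight2 b k = dick_weight b (fst k) + dick_weight b (snd k)"

text \<open>
  Component \<open>i\<close> of the product of the digit row vector of \<open>k\<close> with \<open>C\<close>, before reduction modulo
  \<open>b\<close>; the digit \<open>bdigit b k (l - 1)\<close> is paired with row \<open>l\<close>.
\<close>

definition digits_times :: "nat \<Rightarrow> nat \<Rightarrow> (nat \<Rightarrow> nat \<Rightarrow> nat) \<Rightarrow> nat \<Rightarrow> nat" where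
  "digits_times b k C i = (\<Sum>l\<in>digit_positions b k. bdigit b k (l - 1) * C l i)"

definition dual_net ::
    "nat \<Rightarrow> nat \<Rightarrow> (nat \<Rightarrow> nat \<Rightarrow> nat) \<Rightarrow> (nat \<Rightarrow> nat \<Rightarrow> nat) \<Rightarrow> (nat \<times> nat) set" where
  "dual_net b M C1 C2 =
    {(k1, k2). \<forall>i\<in>{1..M}. (digits_times b k1 C1 i + digits_times b k2 C2 i) mod b = 0}"

text \<open>
  On a nonempty set of natural numbers \<open>Inf\<close> is the minimum; on the empty set it is 0, so a lower
  bound on \<open>min_dick_weight\<close> never holds merely because the dual net is trivial.
\<close>

definition min_dick_weight ::
    "nat \<Rightarrow> nat \<Rightarrow> (nat \<Rightarrow> nat \<Rightarrow> nat) \<Rightarrow> (nat \<Rightarrow> nat \<Rightarrow> nat) \<Rightarrow> nat" where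
  "min_dick_weight b M C1 C2 = Inf (dick_weight2 b ` (dual_net b M C1 C2 - {(0, 0)}))"

definition digital_coord ::
    "nat \<Rightarrow> nat \<Rightarrow> (nat \<Rightarrow> nat \<Rightarrow> nat) \<Rightarrow> (nat \<Rightarrow> nat) \<Rightarrow> real" where
  "digital_coord b M C a =
    (\<Sum>l. real ((\<Sum>i = 1..M. C (Suc l) i * a i) mod b) / real b ^ Suc l)"

definition digital_net ::
    "nat \<Rightarrow> nat \<Rightarrow> (nat \<Rightarrow> nat \<Rightarrow> nat) \<Rightarrow> (nat \<Rightarrow> nat \<Rightarrow> nat) \<Rightarrow> (real \<times> real) multiset" where
  "digital_net b M C1 C2 =
    image_mset (\<lambda>a. (digital_coord b M C1 a, digital_coord b M C2 a)) (mset_set (Zb_vectors b M))"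

definition ham_x :: "nat \<Rightarrow> nat \<Rightarrow> nat \<Rightarrow> (nat \<Rightarrow> nat) \<Rightarrow> real" where
  "ham_x b m n a =
    (\<Sum>l = 1..m. real ((a l + a (m + 1)) mod b) / real b ^ l)
    + (\<Sum>l = m + 1..n. real (a (m + 1)) / real b ^ l)"

definition ham_y :: "nat \<Rightarrow> nat \<Rightarrow> nat \<Rightarrow> (nat \<Rightarrow> nat) \<Rightarrow> real" where
  "ham_y b m n a =
    (\<Sum>l = 1..m. real ((a (m + 1 - l) + a (m + 2)) mod b) / real b ^ l)
    + (\<Sum>l = m + 1..n. real (a (m + 2)) / real b ^ l)"

definition sym_hammersley :: "nat \<Rightarrow> nat \<Rightarrow> nat \<Rightarrow> (real \<times> real) multiset" where
  "sym_hammersley b m n =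
    image_mset (\<lambda>a. (ham_x b m n a, ham_y b m n a)) (mset_set (Zb_vectors b (m + 2)))"

definition unit_row :: "nat \<Rightarrow> nat \<Rightarrow> nat" where
  "unit_row j i = (if i = j then 1 else 0)"

definition ham_C1 :: "nat \<Rightarrow> nat \<Rightarrow> nat \<Rightarrow> nat \<Rightarrow> nat" where
  "ham_C1 m n l i =
    (if 1 \<le> l \<and> l \<le> m then unit_row l i + unit_row (m + 1) i
     else if m < l \<and> l \<le> n then unit_row (m + 1) i
     else 0)"

definition ham_C2 :: "nat \<Rightarrow> nat \<Rightarrow> nat \<Rightarrow> nat \<Rightarrow> nat" where
  "ham_C2 m n l i =
    (if 1 \<le> l \<and> l \<le> m then unit_row (m + 1 - l) i + unit_row (m + 2) i
     else if m < l \<and> l \<le> n then unit_row (m + 2) i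
     else 0)"

definition local_discrepancy :: "(real \<times> real) multiset \<Rightarrow> real \<times> real \<Rightarrow> real" where
  "local_discrepancy P t =
    real (size (filter_mset (\<lambda>z. z \<in> {0..<fst t} \<times> {0..<snd t}) P)) / real (size P)
    - fst t * snd t"

definition Lp_discrepancy :: "real \<Rightarrow> (real \<times> real) multiset \<Rightarrow> real" where
  "Lp_discrepancy p P =
    (LINT t:{0..1} \<times> {0..1}|lborel. \<bar>local_discrepancy P t\<bar> powr p) powr (1 / p)"

text \<open>
  The dual net and the minimum Dick weight are attached to generating matrices.  The following
  lemma justifies using \<open>ham_C1\<close> and \<open>ham_C2\<close> for the symmetrized Hammersley point set.
\<close>

lemma digital_coord_finite:
  assumes "\<And>l i. l > n \<Longrightarrow> C l i = 0"
  shows "digital_coord b M C a = (\<Sum>l = 1..n. real ((\<Sum>i = 1..M. C l i * a i) mod b) / real b ^ l)"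
proof -
  have "digital_coord b M C a
      = (\<Sum>l<n. real ((\<Sum>i = 1..M. C (Suc l) i * a i) mod b) / real b ^ Suc l)"
    unfolding digital_coord_def by (rule suminf_finite) (auto simp: assms)
  also have "\<dots> = (\<Sum>l = 1..n. real ((\<Sum>i = 1..M. C l i * a i) mod b) / real b ^ l)"
    by (rule sum.reindex_bij_witness[of _ "\<lambda>l. l - 1" Suc]) auto
  finally show ?thesis .
qed

lemma sum_unit_row:
  "(\<Sum>i = 1..M. unit_row j i * a i) = (if 1 \<le> j \<and> j \<le> M then a j else 0)"
proof -
  have "(\<Sum>i = 1..M. unit_row j i * a i) = (\<Sum>i = 1..M. if j = i then a i else 0)"
    by (rule sum.cong) (auto simp: unit_row_def)
  then show ?thesis by (simp add: sum.delta)
qed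

lemma sym_hammersley_digital_net:
  assumes "m \<le> n"
  shows "sym_hammersley b m n = digital_net b (m + 2) (ham_C1 m n) (ham_C2 m n)"
proof -
  have split: "(\<Sum>l = 1..n. f l) = (\<Sum>l = 1..m. f l) + (\<Sum>l = m + 1..n. f l)" for f :: "nat \<Rightarrow> real"
  proof -
    have "{1..n} = {1..m} \<union> {m + 1..n}" using assms by auto
    then show ?thesis by (simp add: sum.union_disjoint)
  qed
  have "ham_x b m n a = digital_coord b (m + 2) (ham_C1 m n) a
      \<and> ham_y b m n a = digital_coord b (m + 2) (ham_C2 m n) a"
    if a: "a \<in> Zb_vectors b (m + 2)" for a
  proof -
    have lt: "a (m + 1) < b" "a (m + 2) < b"
      using PiE_mem[OF a[unfolded Zb_vectors_def], of "m + 1"]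
        PiE_mem[OF a[unfolded Zb_vectors_def], of "m + 2"] by auto
    have r1: "(\<Sum>i = 1..m+2. ham_C1 m n l i * a i)
        = (if 1 \<le> l \<and> l \<le> m then a l + a (m + 1) else if m < l \<and> l \<le> n then a (m + 1) else 0)" for l
      using sum_unit_row[of l a "m+2"] sum_unit_row[of "m+1" a "m+2"]
      by (cases "1 \<le> l \<and> l \<le> m"; cases "m < l \<and> l \<le> n")
        (simp_all add: ham_C1_def distrib_right sum.distrib del: sum.cl_ivl_Suc, auto)
    have r2: "(\<Sum>i = 1..m+2. ham_C2 m n l i * a i)
        = (if 1 \<le> l \<and> l \<le> m then a (m + 1 - l) + a (m + 2)
           else if m < l \<and> l \<le> n then a (m + 2) else 0)" for l
      using sum_unit_row[of "m+1-l" a "m+2"] sum_unit_row[of "m+2" a "m+2"]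
      by (cases "1 \<le> l \<and> l \<le> m"; cases "m < l \<and> l \<le> n")
        (simp_all add: ham_C2_def distrib_right sum.distrib del: sum.cl_ivl_Suc, auto)
    have c1: "digital_coord b (m + 2) (ham_C1 m n) a
        = (\<Sum>l = 1..n. real ((\<Sum>i = 1..m+2. ham_C1 m n l i * a i) mod b) / real b ^ l)"
      by (rule digital_coord_finite) (use assms in \<open>auto simp: ham_C1_def\<close>)
    have c2: "digital_coord b (m + 2) (ham_C2 m n) a
        = (\<Sum>l = 1..n. real ((\<Sum>i = 1..m+2. ham_C2 m n l i * a i) mod b) / real b ^ l)"
      by (rule digital_coord_finite) (use assms in \<open>auto simp: ham_C2_def\<close>)
    show ?thesis
      unfolding c1 c2 r1 r2 split ham_x_def ham_y_def
      using lt by (intro conjI arg_cong2[where f = "(+)"] sum.cong) auto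
  qed
  moreover have "finite (Zb_vectors b (m + 2))"
    by (simp add: Zb_vectors_def finite_PiE)
  ultimately show ?thesis
    unfolding sym_hammersley_def digital_net_def by (intro image_mset_cong) auto
qed

end

theory Submission
  imports Defs
begin

text \<open>
  The weight bound is read off from the equations of the dual net.  Column \<open>m + 1\<close> says that the
  first \<open>n\<close> digits of \<open>k\<^sub>1\<close> sum to zero, column \<open>m + 2\<close> says this for \<open>k\<^sub>2\<close>, and column \<open>i \<le> m\<close>
  couples digit \<open>i\<close> of \<open>k\<^sub>1\<close> with digit \<open>m + 1 - i\<close> of \<open>k\<^sub>2\<close>.  Hence nonzero digits come at least in
  pairs, and two positions \<open>i, j \<le> m\<close> in \<open>k\<^sub>1\<close> force the positions \<open>m + 1 - i\<close>, \<open>m + 1 - j\<close> in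
  \<open>k\<^sub>2\<close>; the four add up to \<open>2 m + 2\<close> (\<open>ham_dual_weight_ge\<close>).

  The discrepancy bound is proved by a martingale argument.
  Up to an error of order \<open>b\<^sup>2\<close> in the point count, only the cell of side \<open>1 / b\<^sup>m\<close> that contains a
  point matters, and similarly \<open>t\<close> may be replaced by a corner \<open>(A / b\<^sup>m, B / b\<^sup>m)\<close> of its cell.
  In terms of cells, the point set consists of the graphs of all \<open>b\<close> digit reversals
  \<open>X \<mapsto> R\<^sub>e(X)\<close>, in which each digit is also shifted by \<open>e\<close>, each graph taken \<open>b\<close> times
  (\<open>sum_over_cells\<close>).  So everything rests on
  \<open>D\<^sub>m(A, B) = \<Sum>\<^sub>e (#{X < A. R\<^sub>e(X) < B} - A B / b\<^sup>m)\<close>.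

  Appending a low digit \<open>a\<close> to \<open>A\<close> and a high digit \<open>c\<close> to \<open>B\<close> changes \<open>D\<^sub>m\<close> by
  the sum of \<open>G\<^sub>m(c - x)\<close> over \<open>x < a\<close>, where \<open>G\<^sub>m(e) = [R\<^sub>e(A) < B] - B / b\<^sup>m\<close>, and changes \<open>H\<^sub>m = \<Sum>\<^sub>e G\<^sub>m(e)\<close>
  into \<open>G\<^sub>m(c - a)\<close> (\<open>reversal_discrepancy_Suc\<close>, \<open>sum_excess_Suc\<close>).  Averaged over uniform digits
  \<open>a\<close> and \<open>c\<close>, the first change is \<open>(b - 1) / (2 b) H\<^sub>m\<close>, and the new value of \<open>H\<close> is \<open>H\<^sub>m / b\<close>.
  Therefore \<open>D\<^sub>m + H\<^sub>m / 2\<close> is a martingale with increments bounded in terms of \<open>b\<close>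
  (\<open>sum_increment\<close>, \<open>abs_increment_le\<close>).  This is where the symmetrization enters: for
  the reversal without shift alone, the increments have a mean that adds up to order \<open>m\<close>.

  A martingale with \<open>m\<close> bounded increments is subgaussian at scale \<open>\<surd>m\<close>, which bounds all its
  moments at once (\<open>compensated_discrepancy_exp_moment\<close>, \<open>compensated_discrepancy_moment\<close>).
  Averaging over the cells gives the \<open>L\<^sub>p\<close> bound (\<open>Lp_discrepancy_sym_hammersley\<close>).
\<close>

section \<open>Dick weights of the dual net\<close>

lemma finite_digit_positions:
  assumes "b \<ge> 2"
  shows "finite (digit_positions b k)"
proof (rule finite_subset)
  show "digit_positions b k \<subseteq> {1..k + 1}"
  proof
    fix a assume a: "a \<in> digit_positions b k"
    have "a - 1 \<le> k"
    proof (rule ccontr)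
      assume "\<not> a - 1 \<le> k"
      then have "k < 2 ^ (a - 1)"
        using less_exp[of "a - 1"] by linarith
      also have "\<dots> \<le> b ^ (a - 1)"
        using assms by (intro power_mono) auto
      finally have "bdigit b k (a - 1) = 0"
        by (simp add: bdigit_def)
      then show False
        using a by (simp add: digit_positions_def)
    qed
    moreover have "a \<ge> 1"
      using a by (simp add: digit_positions_def)
    ultimately show "a \<in> {1..k + 1}" by simp
  qed
qed simp

lemma position_le_dick_weight:
  assumes "b \<ge> 2" "a \<in> digit_positions b k"
  shows "a \<le> dick_weight b k"
proof -
  have "a \<le> Max (digit_positions b k)"
    using assms finite_digit_positions by simp
  then show ?thesis
    using assms(2) by (auto simp: dick_weight_def Let_def)
qed

lemma two_positions_le_dick_weight:
  assumes "b \<ge> 2" "a \<in> digit_positions b k" "a' \<in> digit_positions b k" "a \<noteq> a'"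
  shows "a + a' \<le> dick_weight b k"
proof -
  let ?A = "digit_positions b k"
  let ?M = "Max ?A"
  have fin: "finite ?A"
    using assms(1) by (rule finite_digit_positions)
  have le: "a \<le> ?M" "a' \<le> ?M"
    using assms fin by (auto intro: Max_ge)
  have ne: "?A - {?M} \<noteq> {}" "?A \<noteq> {}"
    using assms(2-4) by blast+
  have le': "x \<le> Max (?A - {?M})" if "x \<in> ?A" "x \<noteq> ?M" for x
    using fin that by (intro Max_ge) auto
  have "dick_weight b k = ?M + Max (?A - {?M})"
    unfolding dick_weight_def Let_def using ne by (simp only: if_False)
  moreover have "a + a' \<le> ?M + Max (?A - {?M})"
  proof (cases "a = ?M")
    case True
    then show ?thesis using le'[OF assms(3)] assms(4) by linarith
  next
    case False
    then show ?thesis using le'[OF assms(2) False] le by linarith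
  qed
  ultimately show ?thesis by simp
qed

lemma bdigit_less: "b \<ge> 2 \<Longrightarrow> bdigit b k i < b"
  by (simp add: bdigit_def)

lemma digit_positions_nonempty:
  assumes "b \<ge> 2" "k > 0"
  shows "digit_positions b k \<noteq> {}"
proof -
  have "\<exists>i. bdigit b k i \<noteq> 0"
    using assms(2)
  proof (induction k rule: less_induct)
    case (less k)
    show ?case
    proof (cases "k mod b = 0")
      case True
      then have "k div b > 0"
        using less.prems by (metis add_0_left div_mult_mod_eq gr0I mult_zero_left not_gr0 add_0_right)
      moreover have "k div b < k"
        using less.prems assms(1) by simp
      ultimately obtain i where "bdigit b (k div b) i \<noteq> 0"
        using less.IH by blast
      then have "bdigit b k (Suc i) \<noteq> 0"
        by (simp add: bdigit_def div_mult2_eq)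
      then show ?thesis by blast
    next
      case False
      then have "bdigit b k 0 \<noteq> 0"
        by (simp add: bdigit_def)
      then show ?thesis by blast
    qed
  qed
  then obtain i where "bdigit b k i \<noteq> 0" by blast
  then have "Suc i \<in> digit_positions b k"
    by (simp add: digit_positions_def)
  then show ?thesis by blast
qed

lemma sum_digits_delta:
  assumes "b \<ge> 2" "\<And>l. l \<in> digit_positions b k \<Longrightarrow> C l i = (if l = j then 1 else 0)" "j \<ge> 1"
  shows "digits_times b k C i = bdigit b k (j - 1)"
proof -
  have "digits_times b k C i
      = (\<Sum>l\<in>digit_positions b k. if l = j then bdigit b k (l - 1) else 0)"
    unfolding digits_times_def by (intro sum.cong) (simp_all add: assms(2))
  also have "\<dots> = bdigit b k (j - 1)"
    using assms(3) by (simp add: sum.delta[OF finite_digit_positions[OF assms(1)]])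
      (simp add: digit_positions_def)
  finally show ?thesis .
qed

lemma digits_times_eq_0:
  assumes "\<And>l. l \<in> digit_positions b k \<Longrightarrow> C l i = 0"
  shows "digits_times b k C i = 0"
  unfolding digits_times_def by (intro sum.neutral) (simp add: assms)

text \<open>
  A single nonzero digit lies strictly between \<open>0\<close> and \<open>b\<close>, so it cannot sum to zero modulo \<open>b\<close>.
\<close>
lemma second_position:
  assumes "b \<ge> 2" "a \<in> digit_positions b k"
    and "(\<Sum>l\<in>digit_positions b k. bdigit b k (l - 1)) mod b = 0"
  shows "\<exists>a'\<in>digit_positions b k. a' \<noteq> a"
proof (rule ccontr)
  assume "\<not> ?thesis"
  then have "digit_positions b k = {a}"
    using assms(2) by blast
  then have "bdigit b k (a - 1) mod b = 0"
    using assms(3) by simp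
  moreover have "bdigit b k (a - 1) \<noteq> 0"
    using assms(2) by (simp add: digit_positions_def)
  ultimately show False
    using bdigit_less[OF assms(1), of k "a - 1"] by simp
qed

text \<open>
  The two sum conditions come from the columns \<open>m + 1\<close> and \<open>m + 2\<close> and hold only while no nonzero
  digit lies beyond position \<open>n\<close>; a digit beyond \<open>n\<close> is unconstrained but already weighs at least
  \<open>n + 1 \<ge> 2 m + 2\<close>, which is what \<open>n > 2 m\<close> is for.
\<close>
lemma ham_dual_weight_ge:
  assumes b: "b \<ge> 2" and n: "n > 2 * m"
    and dual: "(k1, k2) \<in> dual_net b (m + 2) (ham_C1 m n) (ham_C2 m n)"
    and ne: "(k1, k2) \<noteq> (0, 0)"
  shows "dick_weight b k1 + dick_weight b k2 > 2 * m + 1"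
proof -
  let ?P1 = "digit_positions b k1" and ?P2 = "digit_positions b k2"
  have pos: "a \<ge> 1" if "a \<in> ?P1 \<union> ?P2" for a
    using that by (auto simp: digit_positions_def)
  have eq: "(digits_times b k1 (ham_C1 m n) i + digits_times b k2 (ham_C2 m n) i) mod b = 0"
    if "i \<in> {1..m + 2}" for i
    using dual that by (auto simp: dual_net_def)
  show ?thesis
  proof (cases "\<exists>a\<in>?P1 \<union> ?P2. a > n")
    case True
    then obtain a where "a \<in> ?P1 \<union> ?P2" "a > n" by blast
    then show ?thesis
      using position_le_dick_weight[OF b, of a k1] position_le_dick_weight[OF b, of a k2] n by auto
  next
    case False
    then have le: "a \<le> n" if "a \<in> ?P1 \<union> ?P2" for a
      using that by (meson not_le)
    have sum1: "(\<Sum>l\<in>?P1. bdigit b k1 (l - 1)) mod b = 0"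
    proof -
      have "digits_times b k2 (ham_C2 m n) (m + 1) = 0"
        by (rule digits_times_eq_0) (auto simp: ham_C2_def unit_row_def)
      moreover have "digits_times b k1 (ham_C1 m n) (m + 1) = (\<Sum>l\<in>?P1. bdigit b k1 (l - 1))"
        unfolding digits_times_def using pos le
        by (intro sum.cong) (auto simp: ham_C1_def unit_row_def not_le Suc_le_eq)
      ultimately show ?thesis
        using eq[of "m + 1"] by simp
    qed
    have sum2: "(\<Sum>l\<in>?P2. bdigit b k2 (l - 1)) mod b = 0"
    proof -
      have "digits_times b k1 (ham_C1 m n) (m + 2) = 0"
        by (rule digits_times_eq_0) (auto simp: ham_C1_def unit_row_def)
      moreover have "digits_times b k2 (ham_C2 m n) (m + 2) = (\<Sum>l\<in>?P2. bdigit b k2 (l - 1))"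
        unfolding digits_times_def using pos le
        by (intro sum.cong) (auto simp: ham_C2_def unit_row_def not_le Suc_le_eq)
      ultimately show ?thesis
        using eq[of "m + 2"] by simp
    qed
    have mirror: "i \<in> ?P1 \<longleftrightarrow> m + 1 - i \<in> ?P2" if i: "i \<in> {1..m}" for i
    proof -
      have "digits_times b k1 (ham_C1 m n) i = bdigit b k1 (i - 1)"
        by (rule sum_digits_delta[OF b]) (use i pos in \<open>auto simp: ham_C1_def unit_row_def\<close>)
      moreover have "digits_times b k2 (ham_C2 m n) i = bdigit b k2 (m + 1 - i - 1)"
        by (rule sum_digits_delta[OF b]) (use i pos in \<open>auto simp: ham_C2_def unit_row_def\<close>)
      ultimately have "b dvd bdigit b k1 (i - 1) + bdigit b k2 (m + 1 - i - 1)"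
        using eq[of i] i by (simp add: mod_eq_0_iff_dvd)
      then have "bdigit b k1 (i - 1) = 0 \<longleftrightarrow> bdigit b k2 (m + 1 - i - 1) = 0"
        using bdigit_less[OF b, of k1 "i - 1"] bdigit_less[OF b, of k2 "m + 1 - i - 1"]
        by (auto dest: nat_dvd_not_less)
      then show ?thesis
        using i by (auto simp: digit_positions_def)
    qed
    show ?thesis
    proof (cases "\<exists>i\<in>{1..m}. i \<in> ?P1")
      case False
      \<comment> \<open>All digits lie beyond position \<open>m\<close>, and a pair of them weighs at least \<open>(m + 1) + (m + 2)\<close>.\<close>
      have far: "a \<ge> m + 1" if "a \<in> ?P1 \<union> ?P2" for a
      proof (rule ccontr)
        assume "\<not> a \<ge> m + 1"
        then have "a \<in> {1..m}" "m + 1 - a \<in> {1..m}" "m + 1 - (m + 1 - a) = a"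
          using pos[OF that] by auto
        then show False
          using that False mirror[of a] mirror[of "m + 1 - a"] by (metis Un_iff)
      qed
      have two: "2 * m + 2 \<le> dick_weight b k"
        if k: "k > 0" "k = k1 \<or> k = k2" for k
      proof -
        obtain a where a: "a \<in> digit_positions b k"
          using digit_positions_nonempty[OF b k(1)] by blast
        obtain a' where a': "a' \<in> digit_positions b k" "a' \<noteq> a"
          using second_position[OF b a] sum1 sum2 k(2) by auto
        show ?thesis
          using two_positions_le_dick_weight[OF b a a'(1)] a'(2) far[of a] far[of a'] a a' k(2)
          by auto
      qed
      then show ?thesis
        using ne two[of k1] two[of k2]
        by (cases "k1 = 0") (auto intro: trans_le_add1 trans_le_add2 simp: Suc_le_eq[symmetric])
    next
      case True
      then obtain i where i: "i \<in> {1..m}" "i \<in> ?P1" by blast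
      then have i2: "m + 1 - i \<in> ?P2" using mirror by simp
      obtain j where j: "j \<in> ?P1" "j \<noteq> i"
        using second_position[OF b i(2) sum1] by blast
      have w1: "i + j \<le> dick_weight b k1"
        using two_positions_le_dick_weight[OF b i(2) j(1)] j(2) by simp
      show ?thesis
      proof (cases "j \<le> m")
        case True
        then have "m + 1 - j \<in> ?P2"
          using mirror[of j] j pos[of j] by simp
        then have "(m + 1 - i) + (m + 1 - j) \<le> dick_weight b k2"
          using two_positions_le_dick_weight[OF b i2] i j True by fastforce
        then show ?thesis using w1 i True by simp
      next
        case False
        \<comment> \<open>The partner \<open>j > m\<close> has no mirror image; the weight at \<open>j\<close> compensates for that.\<close>
        obtain j' where j': "j' \<in> ?P2" "j' \<noteq> m + 1 - i"
          using second_position[OF b i2 sum2] by blast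
        have "(m + 1 - i) + j' \<le> dick_weight b k2"
          using two_positions_le_dick_weight[OF b i2 j'(1)] j'(2) by simp
        then show ?thesis using w1 i False pos[of j'] j' by simp
      qed
    qed
  qed
qed

lemma ham_min_dick_weight:
  assumes b: "b \<ge> 2" and n: "n > 2 * m"
  shows "min_dick_weight b (m + 2) (ham_C1 m n) (ham_C2 m n) > 2 * m + 1"
proof -
  let ?D = "dual_net b (m + 2) (ham_C1 m n) (ham_C2 m n) - {(0, 0)}"
  \<comment> \<open>The number \<open>b\<^sup>n\<close> only meets zero rows, so the minimum is attained and not a default value.\<close>
  have far: "l > n" if "l \<in> digit_positions b (b ^ n)" for l
  proof (rule ccontr)
    assume "\<not> l > n"
    moreover have "l \<ge> 1" using that by (simp add: digit_positions_def)
    ultimately have n_eq: "l - 1 + Suc (n - l) = n" by simp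
    have "b ^ (l - 1 + Suc (n - l)) div b ^ (l - 1) = b * b ^ (n - l)"
      using b by (simp add: power_add)
    then have "bdigit b (b ^ n) (l - 1) = 0"
      unfolding n_eq by (simp add: bdigit_def)
    then show False using that by (simp add: digit_positions_def)
  qed
  have "digits_times b (b ^ n) (ham_C1 m n) i = 0" for i
  proof (rule digits_times_eq_0)
    fix l assume "l \<in> digit_positions b (b ^ n)"
    then have "l > n" by (rule far)
    then show "ham_C1 m n l i = 0" using n by (simp add: ham_C1_def)
  qed
  moreover have "digits_times b 0 (ham_C2 m n) i = 0" for i
    by (rule digits_times_eq_0) (simp add: digit_positions_def bdigit_def)
  ultimately have "(b ^ n, 0) \<in> ?D"
    using b by (simp add: dual_net_def)
  then have "min_dick_weight b (m + 2) (ham_C1 m n) (ham_C2 m n) \<in> dick_weight2 b ` ?D"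
    unfolding min_dick_weight_def by (intro Inf_nat_def1) blast
  then obtain k where k: "k \<in> ?D"
    "min_dick_weight b (m + 2) (ham_C1 m n) (ham_C2 m n) = dick_weight2 b k"
    by blast
  then show ?thesis
    using ham_dual_weight_ge[OF b n, of "fst k" "snd k"]
    by (simp add: dick_weight2_def prod_eq_iff)
qed

section \<open>Cyclic shifts of digits and grouped sums\<close>

lemma mod_add_left_inj:
  fixes d e b x :: nat
  assumes "(x + d) mod b = (x + e) mod b" "d < b" "e < b"
  shows "d = e"
proof -
  have le: "e' \<le> d'" if eq: "(x + d') mod b = (x + e') mod b" and lt: "e' < b" for d' e'
  proof (rule ccontr)
    assume *: "\<not> e' \<le> d'"
    then have "b dvd (x + e') - (x + d')"
      using mod_eq_dvd_iff_nat[of "x + d'" "x + e'" b] eq by simp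
    then have "b dvd e' - d'" by simp
    then show False
      using * lt nat_dvd_not_less[of "e' - d'" b] by simp
  qed
  show ?thesis
    using le[OF assms(1,3)] le[OF assms(1)[symmetric] assms(2)] by simp
qed

lemma sum_rotate_mod:
  fixes f :: "nat \<Rightarrow> 'a::comm_monoid_add"
  assumes "b > 0"
  shows "(\<Sum>e<b. f ((x + e) mod b)) = (\<Sum>e<b. f e)"
proof -
  have inj: "inj_on (\<lambda>e. (x + e) mod b) {..<b}"
    by (metis (no_types, lifting) inj_onI lessThan_iff mod_add_left_inj)
  have "(\<lambda>e. (x + e) mod b) ` {..<b} = {..<b}"
    by (rule endo_inj_surj) (use inj assms in auto)
  then show ?thesis
    using sum.reindex[OF inj, of f] by simp
qed

lemma sum_lessThan_mult:
  fixes f :: "nat \<Rightarrow> 'a::comm_monoid_add"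
  shows "(\<Sum>x<n * k. f x) = (\<Sum>i<n. \<Sum>j<k. f (i * k + j))"
proof -
  have "(\<Sum>i<n. \<Sum>j<k. f (i * k + j)) = (\<Sum>i<n. \<Sum>x\<in>{i * k..<i * k + k}. f x)"
  proof (rule sum.cong[OF refl])
    fix i
    show "(\<Sum>j<k. f (i * k + j)) = (\<Sum>x\<in>{i * k..<i * k + k}. f x)"
      by (rule sum.reindex_bij_witness[of _ "\<lambda>x. x - i * k" "\<lambda>j. i * k + j"]) auto
  qed
  then show ?thesis by (simp add: sum.nat_group)
qed

lemma sum_lessThan_mult_add:
  fixes f :: "nat \<Rightarrow> 'a::comm_monoid_add"
  shows "(\<Sum>x<n * k + r. f x) = (\<Sum>i<n. \<Sum>j<k. f (i * k + j)) + (\<Sum>j<r. f (n * k + j))"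
  by (induction r) (simp_all add: sum_lessThan_mult add.assoc)

text \<open>
  As a weight over the shifts \<open>e\<close>, this selects the single shift \<open>c - x\<close> modulo \<open>b\<close> that carries the
  digit \<open>x\<close> to \<open>c\<close>; as a weight over \<open>x\<close> or over \<open>c\<close> it also has total mass 1.
\<close>
definition hit :: "nat \<Rightarrow> nat \<Rightarrow> nat \<Rightarrow> nat \<Rightarrow> real" where
  "hit b x c e = of_bool ((x + e) mod b = c)"

lemma sum_hit_shift:
  assumes "b > 0" "c < b"
  shows "(\<Sum>e<b. hit b x c e) = 1"
  using sum_rotate_mod[OF assms(1), of "\<lambda>e. of_bool (e = c) :: real" x] assms(2)
  by (simp add: hit_def of_bool_def)

lemma sum_hit_digit:
  assumes "b > 0" "c < b"
  shows "(\<Sum>x<b. hit b x c e) = 1"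
  using sum_hit_shift[OF assms, of e] by (simp add: hit_def add.commute)

lemma sum_hit_target:
  assumes "b > 0"
  shows "(\<Sum>c<b. hit b x c e) = 1"
  using assms by (simp add: hit_def of_bool_def)

lemma sum_shifted_less:
  assumes "b > 0" "c \<le> b"
  shows "(\<Sum>e<b. of_bool ((x + e) mod b < c) :: real) = real c"
proof -
  have "(\<Sum>e<b. of_bool (e < c) :: real) = (\<Sum>e<c. 1)"
    by (rule sum.mono_neutral_cong_right) (use assms in auto)
  then show ?thesis
    using sum_rotate_mod[OF assms(1), of "\<lambda>e. of_bool (e < c) :: real" x] by simp
qed

section \<open>The discrepancy of shifted digit reversals\<close>

text \<open>
  The digits of \<open>X\<close> below \<open>b ^ m\<close> are read in reverse order, and \<open>e\<close> is added to each of them modulo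
  \<open>b\<close>.  The recursion strips the lowest digit of \<open>X\<close>, which becomes the highest digit of the result.
\<close>
fun shifted_reversal :: "nat \<Rightarrow> nat \<Rightarrow> nat \<Rightarrow> nat \<Rightarrow> nat" where
  "shifted_reversal b e 0 X = 0"
| "shifted_reversal b e (Suc m) X =
     shifted_reversal b e m (X div b) + ((X mod b + e) mod b) * b ^ m"

lemma shifted_reversal_less:
  assumes "b > 0"
  shows "shifted_reversal b e m X < b ^ m"
proof (induction m arbitrary: X)
  case (Suc m)
  let ?r = "(X mod b + e) mod b"
  have "shifted_reversal b e (Suc m) X < b ^ m + ?r * b ^ m"
    using Suc by simp
  also have "\<dots> = Suc ?r * b ^ m" by simp
  also have "\<dots> \<le> b * b ^ m"
    by (rule mult_le_mono1) (use assms in \<open>simp add: Suc_le_eq\<close>)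
  finally show ?case by simp
qed simp

text \<open>
  Comparison of \<open>m + 1\<close> digits is lexicographic: the top digits decide unless they agree.
\<close>
lemma of_bool_shifted_reversal_Suc:
  assumes "b > 0" "x < b" "B < b ^ m"
  shows "of_bool (shifted_reversal b e (Suc m) (A * b + x) < c * b ^ m + B) =
    of_bool ((x + e) mod b < c) + hit b x c e * of_bool (shifted_reversal b e m A < B)"
proof -
  let ?r = "(x + e) mod b" and ?R = "shifted_reversal b e m A"
  have R: "?R < b ^ m" using assms(1) by (rule shifted_reversal_less)
  have "shifted_reversal b e (Suc m) (A * b + x) = ?R + ?r * b ^ m"
    using assms by simp
  moreover have "?R + ?r * b ^ m < c * b ^ m + B \<longleftrightarrow> ?r < c \<or> ?r = c \<and> ?R < B"
  proof (cases "?r" c rule: linorder_cases)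
    case less
    then have "Suc ?r * b ^ m \<le> c * b ^ m" by (intro mult_le_mono1) simp
    then show ?thesis using less R by simp
  next
    case equal
    then show ?thesis by simp
  next
    case greater
    then have "Suc c * b ^ m \<le> ?r * b ^ m" by (intro mult_le_mono1) simp
    then show ?thesis using greater assms(3) by simp
  qed
  ultimately show ?thesis by (auto simp: hit_def)
qed

definition reversal_discrepancy :: "nat \<Rightarrow> nat \<Rightarrow> nat \<Rightarrow> nat \<Rightarrow> real" where
  "reversal_discrepancy b m A B =
    (\<Sum>e<b. (\<Sum>X<A. of_bool (shifted_reversal b e m X < B)) - real A * real B / real b ^ m)"

text \<open>
  How far the membership of the next abscissa \<open>A\<close> deviates from its expected value \<open>B / b\<^sup>m\<close>, for
  the reversal with shift \<open>e\<close>.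
\<close>
definition excess :: "nat \<Rightarrow> nat \<Rightarrow> nat \<Rightarrow> nat \<Rightarrow> nat \<Rightarrow> real" where
  "excess b m A B e = of_bool (shifted_reversal b e m A < B) - real B / real b ^ m"

lemma abs_excess_le:
  assumes "b > 0" "B < b ^ m"
  shows "\<bar>excess b m A B e\<bar> \<le> 1"
proof -
  have "real B \<le> real b ^ m"
    using assms(2) by (metis of_nat_less_iff of_nat_power less_imp_le)
  then have "real B / real b ^ m \<le> 1" "real B / real b ^ m \<ge> 0"
    using assms(1) by (auto simp: field_simps)
  then show ?thesis by (auto simp: excess_def of_bool_def)
qed

lemma sum_hit_excess:
  assumes "b > 0" "c < b"
  shows "(\<Sum>e<b. hit b x c e * excess b m A B e) =
    (\<Sum>e<b. hit b x c e * of_bool (shifted_reversal b e m A < B)) - real B / real b ^ m"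
  unfolding excess_def right_diff_distrib sum_subtractf sum_distrib_right[symmetric]
  by (simp add: sum_hit_shift[OF assms])

text \<open>
  Abscissae \<open>X\<close> below \<open>A b\<close> run through complete blocks of \<open>b\<close>.  In a complete block the top digit
  \<open>x + e\<close> of the reversal takes every value once, so the block contributes \<open>c\<close> plus the old
  comparison of the remaining digits.  Only the incomplete block over \<open>A\<close> produces anything new, and
  after summation over the shifts each of its \<open>a\<close> abscissae contributes one selected excess.
\<close>
lemma reversal_discrepancy_Suc:
  assumes b: "b > 0" and a: "a < b" and c: "c < b" and B: "B < b ^ m"
  shows "reversal_discrepancy b (Suc m) (A * b + a) (c * b ^ m + B) =
    reversal_discrepancy b m A B + (\<Sum>x<a. \<Sum>e<b. hit b x c e * excess b m A B e)"
proof -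
  let ?g = "\<lambda>e X. of_bool (shifted_reversal b e m X < B) :: real"
  let ?u = "\<lambda>e x. of_bool ((x + e) mod b < c) :: real"
  have step: "(\<Sum>X<A * b + a. of_bool (shifted_reversal b e (Suc m) X < c * b ^ m + B)) =
      real A * real c + (\<Sum>X<A. ?g e X) + (\<Sum>x<a. ?u e x + hit b x c e * ?g e A)" for e
  proof -
    \<comment> \<open>contribution of a complete block\<close>
    have "(\<Sum>x<b. ?u e x + hit b x c e * ?g e X) = real c + ?g e X" for X
    proof -
      have "(\<Sum>x<b. ?u e x) = real c"
        using sum_shifted_less[OF b, of c e] c by (simp add: add.commute)
      then show ?thesis
        using sum_hit_digit[OF b c, of e] by (simp add: sum.distrib flip: sum_distrib_right)
    qed
    then have full: "(\<Sum>X<A. \<Sum>x<b. ?u e x + hit b x c e * ?g e X) = real A * real c + (\<Sum>X<A. ?g e X)"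
      by (simp add: sum.distrib)
    have "(\<Sum>X<A * b + a. of_bool (shifted_reversal b e (Suc m) X < c * b ^ m + B)) =
        (\<Sum>X<A. \<Sum>x<b. ?u e x + hit b x c e * ?g e X) + (\<Sum>x<a. ?u e x + hit b x c e * ?g e A)"
      unfolding sum_lessThan_mult_add using a
      by (intro arg_cong2[where f = "(+)"] sum.cong refl of_bool_shifted_reversal_Suc b B) auto
    then show ?thesis using full by simp
  qed
  have part: "(\<Sum>e<b. \<Sum>x<a. ?u e x + hit b x c e * ?g e A) =
      (\<Sum>x<a. (\<Sum>e<b. hit b x c e * excess b m A B e)) + real a * (real c + real B / real b ^ m)"
  proof -
    have "(\<Sum>e<b. \<Sum>x<a. ?u e x + hit b x c e * ?g e A) =
        (\<Sum>x<a. (\<Sum>e<b. ?u e x) + (\<Sum>e<b. hit b x c e * ?g e A))"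
      by (subst sum.swap) (simp add: sum.distrib)
    also have "\<dots> = (\<Sum>x<a. (\<Sum>e<b. hit b x c e * excess b m A B e) + (real c + real B / real b ^ m))"
      using sum_shifted_less[OF b, of c] c sum_hit_excess[OF b c, of _ m A B]
      by (intro sum.cong) simp_all
    finally show ?thesis by (simp add: sum.distrib)
  qed
  have b0: "real b > 0" using b by simp
  have "reversal_discrepancy b (Suc m) (A * b + a) (c * b ^ m + B) =
      real b * real A * real c + (\<Sum>e<b. \<Sum>X<A. ?g e X)
      + (\<Sum>e<b. \<Sum>x<a. ?u e x + hit b x c e * ?g e A)
      - real b * ((real A * real b + real a) * (real c * real b ^ m + real B) / real b ^ Suc m)"
    unfolding reversal_discrepancy_def sum_subtractf step by (simp add: sum.distrib)
  also have "\<dots> = (\<Sum>e<b. \<Sum>X<A. ?g e X) - real b * (real A * real B / real b ^ m)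
      + (\<Sum>x<a. \<Sum>e<b. hit b x c e * excess b m A B e)"
    unfolding part using b0 by (simp add: field_simps)
  finally show ?thesis
    by (simp add: reversal_discrepancy_def sum_subtractf)
qed

text \<open>
  Over all shifts the top digit takes every value once; this contributes exactly \<open>c\<close>, which cancels
  against the leading term of the expected value, and one selected excess remains.
\<close>
lemma sum_excess_Suc:
  assumes b: "b > 0" and a: "a < b" and c: "c < b" and B: "B < b ^ m"
  shows "(\<Sum>e<b. excess b (Suc m) (A * b + a) (c * b ^ m + B) e) =
    (\<Sum>e<b. hit b a c e * excess b m A B e)"
proof -
  have b0: "real b > 0" using b by simp
  have "(\<Sum>e<b. excess b (Suc m) (A * b + a) (c * b ^ m + B) e) =
      (\<Sum>e<b. of_bool ((a + e) mod b < c))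
      + (\<Sum>e<b. hit b a c e * of_bool (shifted_reversal b e m A < B))
      - real b * ((real c * real b ^ m + real B) / real b ^ Suc m)"
    unfolding excess_def of_bool_shifted_reversal_Suc[OF b a B] sum_subtractf sum.distrib by simp
  also have "\<dots> = real c + ((\<Sum>e<b. hit b a c e * excess b m A B e) + real B / real b ^ m)
      - real b * ((real c * real b ^ m + real B) / real b ^ Suc m)"
    using sum_shifted_less[OF b, of c a] c sum_hit_excess[OF b c, of a m A B] by simp
  finally show ?thesis using b0 by (simp add: field_simps)
qed

text \<open>
  Half the total excess turns the discrepancy into a martingale in \<open>m\<close>: if the total excess is \<open>H\<close>,
  one step adds \<open>(b - 1) / (2 b) H\<close> to the discrepancy on average and replaces \<open>H\<close> by \<open>H / b\<close>.
\<close>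
definition compensated_discrepancy :: "nat \<Rightarrow> nat \<Rightarrow> nat \<Rightarrow> nat \<Rightarrow> real" where
  "compensated_discrepancy b m A B =
    reversal_discrepancy b m A B + (\<Sum>e<b. excess b m A B e) / 2"

definition increment :: "nat \<Rightarrow> nat \<Rightarrow> nat \<Rightarrow> nat \<Rightarrow> nat \<Rightarrow> nat \<Rightarrow> real" where
  "increment b m A B a c =
    (\<Sum>x<a. \<Sum>e<b. hit b x c e * excess b m A B e)
    + (\<Sum>e<b. hit b a c e * excess b m A B e) / 2 - (\<Sum>e<b. excess b m A B e) / 2"

lemma compensated_discrepancy_Suc:
  assumes "b > 0" "a < b" "c < b" "B < b ^ m"
  shows "compensated_discrepancy b (Suc m) (A * b + a) (c * b ^ m + B) =
    compensated_discrepancy b m A B + increment b m A B a c"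
  using assms
  by (simp add: compensated_discrepancy_def increment_def reversal_discrepancy_Suc sum_excess_Suc)

text \<open>
  Summing over the high digit \<open>c\<close> turns each selected excess into the total excess \<open>H\<close>.  The three
  terms then give \<open>b (b - 1) / 2\<close>, \<open>b / 2\<close> and \<open>- b\<^sup>2 / 2\<close> times \<open>H\<close>.
\<close>
lemma sum_increment:
  assumes b: "b > 0"
  shows "(\<Sum>a<b. \<Sum>c<b. increment b m A B a c) = 0"
proof -
  let ?H = "\<Sum>e<b. excess b m A B e"
  have hits: "(\<Sum>c<b. \<Sum>e<b. hit b x c e * excess b m A B e) = ?H" for x
    using sum_hit_target[OF b, of x] by (subst sum.swap) (simp flip: sum_distrib_right)
  have "(\<Sum>c<b. increment b m A B a c) = real a * ?H + ?H / 2 - real b * (?H / 2)" for a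
  proof -
    have "(\<Sum>c<b. \<Sum>x<a. \<Sum>e<b. hit b x c e * excess b m A B e) = real a * ?H"
      by (subst sum.swap) (simp add: hits)
    then show ?thesis
      by (simp add: increment_def sum.distrib sum_subtractf hits flip: sum_divide_distrib)
  qed
  then have "(\<Sum>a<b. \<Sum>c<b. increment b m A B a c)
      = (\<Sum>a<b. real a) * ?H + real b * (?H / 2) - real b * (real b * (?H / 2))"
    by (simp add: sum.distrib sum_subtractf flip: sum_distrib_right)
  moreover have "(\<Sum>a<b. real a) = real b * (real b - 1) / 2"
    by (induction b) (simp_all add: field_simps)
  ultimately have "(\<Sum>a<b. \<Sum>c<b. increment b m A B a c) =
      real b * (real b - 1) / 2 * ?H + real b * (?H / 2) - real b * (real b * (?H / 2))"
    by (simp only:)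
  also have "\<dots> = 0" by (simp add: field_simps)
  finally show ?thesis .
qed

lemma abs_increment_le:
  assumes b: "b > 0" and a: "a < b" and c: "c < b" and B: "B < b ^ m"
  shows "\<bar>increment b m A B a c\<bar> \<le> 2 * real b"
proof -
  have hit: "\<bar>\<Sum>e<b. hit b x c e * excess b m A B e\<bar> \<le> 1" for x
  proof -
    have "\<bar>\<Sum>e<b. hit b x c e * excess b m A B e\<bar> \<le> (\<Sum>e<b. hit b x c e)"
      using abs_excess_le[OF b B]
      by (intro order.trans[OF sum_abs] sum_mono) (auto simp: hit_def of_bool_def)
    then show ?thesis using sum_hit_shift[OF b c, of x] by simp
  qed
  have "\<bar>\<Sum>x<a. \<Sum>e<b. hit b x c e * excess b m A B e\<bar> \<le> (\<Sum>x<a. 1)"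
    by (intro order.trans[OF sum_abs] sum_mono hit)
  moreover have "\<bar>\<Sum>e<b. excess b m A B e\<bar> \<le> (\<Sum>e<b. 1)"
    using abs_excess_le[OF b B] by (intro order.trans[OF sum_abs] sum_mono) auto
  moreover have "real a \<le> real b - 1" using a by linarith
  ultimately show ?thesis
    using hit[of a] b unfolding increment_def by simp
qed

section \<open>Exponential moments\<close>

lemma exp_le_quadratic:
  fixes x K :: real
  assumes "\<bar>x\<bar> \<le> K"
  shows "exp x \<le> 1 + x + exp K * x\<^sup>2"
proof -
  obtain t where t: "\<bar>t\<bar> \<le> \<bar>x\<bar>" "exp x = (\<Sum>k<2. x ^ k / fact k) + exp t / fact 2 * x ^ 2"
    using Maclaurin_exp_le[of x 2] by blast
  have "exp t / 2 \<le> exp K"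
    using t(1) assms by (smt (verit) exp_le_cancel_iff exp_gt_zero field_sum_of_halves)
  then have "exp t / 2 * x\<^sup>2 \<le> exp K * x\<^sup>2"
    by (intro mult_right_mono) auto
  then show ?thesis using t(2) by (simp add: numeral_2_eq_2)
qed

definition moment_const :: "nat \<Rightarrow> real" where
  "moment_const b = 4 * (real b)\<^sup>2 * exp (2 * real b)"

text \<open>
  The usual exponential moment bound for a martingale with bounded increments, written for the
  uniform distribution of \<open>(A, B)\<close>: in each step the linear term of the exponential vanishes on
  average and the quadratic term costs a factor of at most \<open>exp (moment_const b * s\<^sup>2)\<close>.
\<close>
lemma compensated_discrepancy_exp_moment:
  fixes s :: real
  assumes b: "b > 0" and s: "\<bar>s\<bar> \<le> 1"
  shows "(\<Sum>A<b ^ m. \<Sum>B<b ^ m. exp (s * compensated_discrepancy b m A B))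
    \<le> real b ^ (2 * m) * exp (real m * moment_const b * s\<^sup>2)"
  unfolding moment_const_def
proof (induction m)
  case 0
  then show ?case
    by (simp add: compensated_discrepancy_def reversal_discrepancy_def excess_def)
next
  case (Suc m)
  define K where "K = 4 * (real b)\<^sup>2 * exp (2 * real b)"
  let ?S = "compensated_discrepancy b m"
  have step: "(\<Sum>a<b. \<Sum>c<b. exp (s * increment b m A B a c)) \<le> (real b)\<^sup>2 * exp (K * s\<^sup>2)"
    if B: "B < b ^ m" for A B
  proof -
    have one: "exp (s * increment b m A B a c) \<le> 1 + s * increment b m A B a c + K * s\<^sup>2"
      if "a < b" "c < b" for a c
    proof -
      let ?d = "increment b m A B a c"
      have d: "\<bar>?d\<bar> \<le> 2 * real b" using abs_increment_le[OF b that B] .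
      have "\<bar>s * ?d\<bar> \<le> 1 * (2 * real b)"
        unfolding abs_mult by (intro mult_mono s d) auto
      then have "exp (s * ?d) \<le> 1 + s * ?d + exp (2 * real b) * (s * ?d)\<^sup>2"
        by (intro exp_le_quadratic) simp
      moreover have "?d\<^sup>2 \<le> (2 * real b)\<^sup>2"
        using d by (simp only: flip: abs_le_square_iff)
      then have "(exp (2 * real b) * s\<^sup>2) * ?d\<^sup>2 \<le> (exp (2 * real b) * s\<^sup>2) * (2 * real b)\<^sup>2"
        by (intro mult_left_mono) auto
      ultimately show ?thesis by (simp add: K_def power_mult_distrib mult_ac)
    qed
    have "(\<Sum>a<b. \<Sum>c<b. exp (s * increment b m A B a c))
        \<le> (\<Sum>a<b. \<Sum>c<b. 1 + s * increment b m A B a c + K * s\<^sup>2)"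
      by (intro sum_mono one) auto
    also have "\<dots> = (real b)\<^sup>2 * (1 + K * s\<^sup>2) + s * (\<Sum>a<b. \<Sum>c<b. increment b m A B a c)"
      by (simp add: sum.distrib sum_distrib_left power2_eq_square algebra_simps)
    also have "\<dots> = (real b)\<^sup>2 * (1 + K * s\<^sup>2)"
      using sum_increment[OF b] by simp
    also have "\<dots> \<le> (real b)\<^sup>2 * exp (K * s\<^sup>2)"
      by (intro mult_left_mono exp_ge_add_one_self) auto
    finally show ?thesis .
  qed
  have low: "(\<Sum>A<b ^ Suc m. f A) = (\<Sum>A<b ^ m. \<Sum>a<b. f (A * b + a))" for f :: "nat \<Rightarrow> real"
    unfolding power_Suc2 by (rule sum_lessThan_mult)
  have high: "(\<Sum>B<b ^ Suc m. f B) = (\<Sum>c<b. \<Sum>B<b ^ m. f (c * b ^ m + B))" for f :: "nat \<Rightarrow> real"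
    unfolding power_Suc by (rule sum_lessThan_mult)
  have "(\<Sum>A<b ^ Suc m. \<Sum>B<b ^ Suc m. exp (s * compensated_discrepancy b (Suc m) A B))
      = (\<Sum>A<b ^ m. \<Sum>a<b. \<Sum>B<b ^ Suc m. exp (s * compensated_discrepancy b (Suc m) (A * b + a) B))"
    by (rule low)
  also have "\<dots> = (\<Sum>A<b ^ m. \<Sum>a<b. \<Sum>c<b. \<Sum>B<b ^ m.
          exp (s * compensated_discrepancy b (Suc m) (A * b + a) (c * b ^ m + B)))"
    by (intro sum.cong refl high)
  also have "\<dots> = (\<Sum>A<b ^ m. \<Sum>a<b. \<Sum>c<b. \<Sum>B<b ^ m. exp (s * ?S A B) * exp (s * increment b m A B a c))"
    using b by (intro sum.cong refl) (simp add: compensated_discrepancy_Suc distrib_left exp_add)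
  also have "\<dots> = (\<Sum>A<b ^ m. \<Sum>a<b. \<Sum>B<b ^ m. \<Sum>c<b. exp (s * ?S A B) * exp (s * increment b m A B a c))"
    by (intro sum.cong refl sum.swap)
  also have "\<dots> = (\<Sum>A<b ^ m. \<Sum>B<b ^ m. \<Sum>a<b. \<Sum>c<b. exp (s * ?S A B) * exp (s * increment b m A B a c))"
    by (intro sum.cong refl sum.swap)
  also have "\<dots> = (\<Sum>A<b ^ m. \<Sum>B<b ^ m. exp (s * ?S A B) * (\<Sum>a<b. \<Sum>c<b. exp (s * increment b m A B a c)))"
    by (simp add: sum_distrib_left)
  also have "\<dots> \<le> (\<Sum>A<b ^ m. \<Sum>B<b ^ m. exp (s * ?S A B) * ((real b)\<^sup>2 * exp (K * s\<^sup>2)))"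
    by (intro sum_mono mult_left_mono step) auto
  also have "\<dots> = (\<Sum>A<b ^ m. \<Sum>B<b ^ m. exp (s * ?S A B)) * ((real b)\<^sup>2 * exp (K * s\<^sup>2))"
    by (simp add: sum_distrib_right)
  also have "\<dots> \<le> (real b ^ (2 * m) * exp (real m * K * s\<^sup>2)) * ((real b)\<^sup>2 * exp (K * s\<^sup>2))"
    using Suc.IH unfolding K_def[symmetric] by (intro mult_right_mono) auto
  also have "\<dots> = real b ^ (2 * Suc m) * exp (real (Suc m) * K * s\<^sup>2)"
    by (simp add: exp_add[symmetric] power2_eq_square algebra_simps)
  finally show ?case unfolding K_def .
qed

section \<open>Moments of the discrepancy of digit reversals\<close>

lemma powr_le_exp:
  fixes u p :: real
  assumes "u \<ge> 0" "p > 0"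
  shows "u powr p \<le> p powr p * exp u"
proof -
  have "u / p \<le> exp (u / p)"
    using exp_ge_add_one_self[of "u / p"] by linarith
  then have "u \<le> p * exp (u / p)"
    using assms by (simp add: field_simps)
  then have "u powr p \<le> (p * exp (u / p)) powr p"
    using assms by (intro powr_mono2) auto
  also have "\<dots> = p powr p * exp u"
    using assms by (simp add: powr_mult exp_powr_real)
  finally show ?thesis .
qed

text \<open>
  Exponential moments at the parameters \<open>\<plusminus> 1 / \<surd>(m + 2)\<close> are bounded independently of \<open>m\<close>, and they
  dominate every power of the rescaled martingale.  The summand 1 absorbs the bounded error between
  this martingale and the discrepancy of the point set.
\<close>
lemma compensated_discrepancy_moment:
  fixes p :: real
  assumes b: "b > 0" and p: "p > 0"
  shows "(\<Sum>A<b ^ m. \<Sum>B<b ^ m.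
      (\<bar>compensated_discrepancy b m A B\<bar> / sqrt (real (m + 2)) + 1) powr p)
    \<le> real b ^ (2 * m) * (p powr p * (2 * exp (moment_const b + 1)))"
proof -
  define s where "s = 1 / sqrt (real (m + 2))"
  let ?S = "compensated_discrepancy b m"
  let ?E = "\<lambda>r. \<Sum>A<b ^ m. \<Sum>B<b ^ m. exp (r * ?S A B)"
  have s0: "s > 0" by (simp add: s_def)
  have s1: "s \<le> 1" by (simp add: s_def)
  have s2: "s\<^sup>2 = 1 / real (m + 2)" by (simp add: s_def power_divide)
  have K: "moment_const b \<ge> 0" by (simp add: moment_const_def)
  have exp_moment: "?E r \<le> real b ^ (2 * m) * exp (moment_const b)" if "\<bar>r\<bar> = s" for r
  proof -
    have r2: "r\<^sup>2 = s\<^sup>2" using that by (metis power2_abs)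
    have "real m * s\<^sup>2 \<le> 1" unfolding s2 by simp
    then have "moment_const b * (real m * s\<^sup>2) \<le> moment_const b * 1"
      using K by (intro mult_left_mono)
    then have "real m * moment_const b * r\<^sup>2 \<le> moment_const b"
      unfolding r2 by (simp add: mult_ac)
    moreover have "?E r \<le> real b ^ (2 * m) * exp (real m * moment_const b * r\<^sup>2)"
      by (rule compensated_discrepancy_exp_moment) (use b that s1 in auto)
    ultimately show ?thesis
      by (meson exp_le_cancel_iff mult_left_mono order_trans zero_le_power of_nat_0_le_iff)
  qed
  have "(\<bar>?S A B\<bar> / sqrt (real (m + 2)) + 1) powr p
      \<le> p powr p * exp 1 * (exp (s * ?S A B) + exp (- s * ?S A B))" for A B
  proof -
    have "(\<bar>?S A B\<bar> / sqrt (real (m + 2)) + 1) powr p \<le> p powr p * exp (s * \<bar>?S A B\<bar> + 1)"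
      using powr_le_exp[of "s * \<bar>?S A B\<bar> + 1" p] p s0 by (simp add: s_def)
    also have "\<dots> = p powr p * exp 1 * exp (s * \<bar>?S A B\<bar>)"
      by (simp add: exp_add)
    also have "\<dots> \<le> p powr p * exp 1 * (exp (s * ?S A B) + exp (- s * ?S A B))"
      by (intro mult_left_mono) (auto simp: abs_if)
    finally show ?thesis .
  qed
  then have "(\<Sum>A<b ^ m. \<Sum>B<b ^ m. (\<bar>?S A B\<bar> / sqrt (real (m + 2)) + 1) powr p)
      \<le> (\<Sum>A<b ^ m. \<Sum>B<b ^ m. p powr p * exp 1 * (exp (s * ?S A B) + exp (- s * ?S A B)))"
    by (intro sum_mono)
  also have "\<dots> = p powr p * exp 1 * (?E s + ?E (- s))"
    by (simp add: sum.distrib sum_distrib_left distrib_left)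
  also have "\<dots> \<le> p powr p * exp 1 *
      (real b ^ (2 * m) * exp (moment_const b) + real b ^ (2 * m) * exp (moment_const b))"
    using s0 by (intro mult_left_mono add_mono exp_moment) auto
  also have "\<dots> = real b ^ (2 * m) * (p powr p * (2 * exp (moment_const b + 1)))"
    by (simp add: exp_add)
  finally show ?thesis .
qed

section \<open>The point set as a union of shifted digit reversals\<close>

fun horner :: "nat \<Rightarrow> (nat \<Rightarrow> nat) \<Rightarrow> nat \<Rightarrow> nat" where
  "horner b f 0 = 0"
| "horner b f (Suc m) = horner b f m * b + f (Suc m)"

lemma horner_less:
  assumes "\<And>i. f i < b"
  shows "horner b f m < b ^ m"
proof (induction m)
  case (Suc m)
  have "horner b f (Suc m) < Suc (horner b f m) * b"
    using assms[of "Suc m"] by simp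
  also have "\<dots> \<le> b ^ m * b"
    using Suc by (intro mult_le_mono1) simp
  finally show ?case by (simp add: mult.commute)
qed simp

lemma horner_inj:
  assumes "\<And>i. f i < b" "\<And>i. g i < b" "horner b f m = horner b g m" "i \<in> {1..m}"
  shows "f i = g i"
  using assms(3,4)
proof (induction m)
  case (Suc m)
  have "(horner b f m * b + f (Suc m)) div b = horner b f m"
    "(horner b g m * b + g (Suc m)) div b = horner b g m"
    "(horner b f m * b + f (Suc m)) mod b = f (Suc m)"
    "(horner b g m * b + g (Suc m)) mod b = g (Suc m)"
    using assms(1,2)[of "Suc m"] by auto
  then have "horner b f m = horner b g m" "f (Suc m) = g (Suc m)"
    using Suc.prems(1) by auto
  then show ?case
    using Suc.IH Suc.prems(2) by (cases "i = Suc m") auto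
qed simp

lemma sum_digits_eq_horner:
  assumes "b > 0"
  shows "(\<Sum>l = 1..m. real (f l) / real b ^ l) = real (horner b f m) / real b ^ m"
  by (induction m) (use assms in \<open>simp_all add: field_simps\<close>)

text \<open>
  The abscissa digits are \<open>a\<^sub>l + c\<close> and the ordinate digits are \<open>a\<^sub>l + d\<close> in reverse order, so the
  ordinate depends on the abscissa and on the difference \<open>d - c\<close> only.
\<close>
lemma shifted_reversal_horner:
  assumes b: "b > 0" and c: "c < b"
  shows "shifted_reversal b ((d + (b - c)) mod b) m (horner b (\<lambda>l. (a l + c) mod b) m) =
    (\<Sum>i = 1..m. (a i + d) mod b * b ^ (i - 1))"
proof (induction m)
  case (Suc m)
  let ?h = "horner b (\<lambda>l. (a l + c) mod b) m"
  let ?r = "(a (Suc m) + c) mod b"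
  have div_mod: "(?h * b + ?r) div b = ?h" "(?h * b + ?r) mod b = ?r"
    using b by auto
  have "(?r + (d + (b - c)) mod b) mod b = (a (Suc m) + c + (d + (b - c))) mod b"
    by (rule mod_add_eq)
  also have "\<dots> = (a (Suc m) + d + b) mod b"
    using c by (intro arg_cong[where f = "\<lambda>x. x mod b"]) simp
  finally have "(?r + (d + (b - c)) mod b) mod b = (a (Suc m) + d) mod b"
    by simp
  then show ?case
    by (simp only: horner.simps shifted_reversal.simps div_mod Suc.IH) simp
qed simp

lemma inj_on_shifted_reversal:
  assumes b: "b > 0"
  shows "inj_on (shifted_reversal b e m) {..<b ^ m}"
proof (induction m)
  case (Suc m)
  show ?case
  proof (rule inj_onI)
    fix X Y assume X: "X \<in> {..<b ^ Suc m}" and Y: "Y \<in> {..<b ^ Suc m}"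
      and eq: "shifted_reversal b e (Suc m) X = shifted_reversal b e (Suc m) Y"
    have parts: "shifted_reversal b e (Suc m) Z mod b ^ m = shifted_reversal b e m (Z div b)"
      "shifted_reversal b e (Suc m) Z div b ^ m = (Z mod b + e) mod b" for Z
      using shifted_reversal_less[OF b, of e m "Z div b"] b by simp_all
    have "shifted_reversal b e m (X div b) = shifted_reversal b e m (Y div b)"
      using parts(1)[of X] parts(1)[of Y] eq by (simp only:)
    moreover have "X div b < b ^ m" "Y div b < b ^ m"
      using X Y by (auto intro!: less_mult_imp_div_less simp: mult.commute)
    ultimately have "X div b = Y div b"
      using Suc.IH by (simp add: inj_on_eq_iff)
    moreover have "(e + X mod b) mod b = (e + Y mod b) mod b"
      using parts(2)[of X] parts(2)[of Y] eq by (simp only: add.commute)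
    then have "X mod b = Y mod b"
      by (rule mod_add_left_inj) (use b in auto)
    ultimately show "X = Y"
      by (metis div_mult_mod_eq)
  qed
qed (simp add: inj_on_def)

lemma finite_Zb_vectors: "finite (Zb_vectors b M)"
  by (simp add: Zb_vectors_def finite_PiE)

lemma card_Zb_vectors: "card (Zb_vectors b M) = b ^ M"
  by (simp add: Zb_vectors_def card_PiE)

text \<open>
  The abscissa of a point lies in \<open>[X / b\<^sup>m, (X + 1) / b\<^sup>m)\<close> for \<open>X = cell_x b m a\<close>, and its ordinate in
  the corresponding interval for \<open>cell_y b m a\<close>: the digits after position \<open>m\<close> never reach the next
  cell.
\<close>
definition cell_x :: "nat \<Rightarrow> nat \<Rightarrow> (nat \<Rightarrow> nat) \<Rightarrow> nat" where
  "cell_x b m a = horner b (\<lambda>l. (a l + a (m + 1)) mod b) m"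

definition cell_shift :: "nat \<Rightarrow> nat \<Rightarrow> (nat \<Rightarrow> nat) \<Rightarrow> nat" where
  "cell_shift b m a = (a (m + 2) + (b - a (m + 1))) mod b"

definition cell_y :: "nat \<Rightarrow> nat \<Rightarrow> (nat \<Rightarrow> nat) \<Rightarrow> nat" where
  "cell_y b m a = shifted_reversal b (cell_shift b m a) m (cell_x b m a)"

lemma Zb_vectors_less: "a \<in> Zb_vectors b M \<Longrightarrow> i \<in> {1..M} \<Longrightarrow> a i < b"
  by (auto simp: Zb_vectors_def dest: PiE_mem)

text \<open>
  The abscissa cell, the digit \<open>a (m + 1)\<close> and the shift determine all digits in turn; equality of
  cardinalities gives surjectivity.
\<close>
lemma bij_betw_cells:
  assumes b: "b > 0"
  shows "bij_betw (\<lambda>a. (cell_x b m a, a (m + 1), cell_shift b m a))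
    (Zb_vectors b (m + 2)) ({..<b ^ m} \<times> {..<b} \<times> {..<b})"
proof -
  let ?V = "Zb_vectors b (m + 2)" and ?T = "{..<b ^ m} \<times> {..<b} \<times> {..<b}"
  let ?f = "\<lambda>a. (cell_x b m a, a (m + 1), cell_shift b m a)"
  have inj: "inj_on ?f ?V"
  proof (rule inj_onI)
    fix a a' assume a: "a \<in> ?V" and a': "a' \<in> ?V" and eq: "?f a = ?f a'"
    have less: "a i < b" "a' i < b" if "i \<in> {1..m + 2}" for i
      using a a' that by (auto intro: Zb_vectors_less)
    define c where "c = a (m + 1)"
    have c: "a (m + 1) = c" "a' (m + 1) = c" using eq by (auto simp: c_def)
    have "((b - c) + a (m + 2)) mod b = ((b - c) + a' (m + 2)) mod b"
      using eq unfolding cell_shift_def c prod.inject by (simp only: add.commute[of "b - c"])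
    then have d: "a (m + 2) = a' (m + 2)"
      by (rule mod_add_left_inj) (use less in auto)
    have "a i = a' i" if i: "i \<in> {1..m}" for i
    proof -
      have "horner b (\<lambda>l. (a l + c) mod b) m = horner b (\<lambda>l. (a' l + c) mod b) m"
        using eq unfolding cell_x_def c by blast
      then have "(a i + c) mod b = (a' i + c) mod b"
        using horner_inj[of "\<lambda>l. (a l + c) mod b" b "\<lambda>l. (a' l + c) mod b" m i] b i by simp
      then have "(c + a i) mod b = (c + a' i) mod b"
        by (simp only: add.commute)
      then show ?thesis
        by (rule mod_add_left_inj) (use less i in auto)
    qed
    then have "a i = a' i" if "i \<in> {1..m + 2}" for i
      using that c d by (cases "i \<le> m"; cases "i = m + 1"; cases "i = m + 2") auto
    then show "a = a'"
      using a a' unfolding Zb_vectors_def by (intro PiE_ext) auto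
  qed
  have "?f ` ?V \<subseteq> ?T"
  proof
    fix y assume "y \<in> ?f ` ?V"
    then obtain a where a: "a \<in> ?V" "y = ?f a" by blast
    have "cell_x b m a < b ^ m"
      unfolding cell_x_def by (rule horner_less) (use b in simp)
    then show "y \<in> ?T"
      using a b Zb_vectors_less[OF a(1), of "m + 1"] by (simp add: cell_shift_def)
  qed
  moreover have "card (?f ` ?V) = card ?T"
    using card_image[OF inj] by (simp add: card_Zb_vectors mult_ac)
  ultimately have "?f ` ?V = ?T"
    by (intro card_subset_eq) auto
  with inj show ?thesis by (simp add: bij_betw_def)
qed

lemma sum_over_cells:
  fixes F :: "nat \<Rightarrow> nat \<Rightarrow> real"
  assumes b: "b > 0"
  shows "(\<Sum>a\<in>Zb_vectors b (m + 2). F (cell_x b m a) (cell_y b m a)) =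
    real b * (\<Sum>e<b. \<Sum>X<b ^ m. F X (shifted_reversal b e m X))"
proof -
  have "(\<Sum>a\<in>Zb_vectors b (m + 2). F (cell_x b m a) (cell_y b m a)) =
      (\<Sum>(X, c, e)\<in>{..<b ^ m} \<times> {..<b} \<times> {..<b}. F X (shifted_reversal b e m X))"
    using sum.reindex_bij_betw[OF bij_betw_cells[OF b],
        of "\<lambda>(X, c, e). F X (shifted_reversal b e m X)" m]
    by (simp add: cell_y_def)
  also have "\<dots> = (\<Sum>X<b ^ m. \<Sum>(c, e)\<in>{..<b} \<times> {..<b}. F X (shifted_reversal b e m X))"
    by (rule sum.cartesian_product[symmetric])
  also have "\<dots> = (\<Sum>X<b ^ m. \<Sum>c<b. \<Sum>e<b. F X (shifted_reversal b e m X))"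
    by (intro sum.cong refl sum.cartesian_product[symmetric])
  also have "\<dots> = real b * (\<Sum>e<b. \<Sum>X<b ^ m. F X (shifted_reversal b e m X))"
  proof -
    have "(\<Sum>X<b ^ m. \<Sum>c<b. \<Sum>e<b. F X (shifted_reversal b e m X)) =
        real b * (\<Sum>X<b ^ m. \<Sum>e<b. F X (shifted_reversal b e m X))"
      by (simp add: sum_distrib_left)
    then show ?thesis by (simp only: sum.swap[of _ "{..<b ^ m}"])
  qed
  finally show ?thesis .
qed

lemma sum_tail_bounds:
  assumes b: "b > 0" and c: "c < b" and n: "m \<le> n"
  shows "(\<Sum>l = m + 1..n. real c / real b ^ l) \<ge> 0"
    and "(\<Sum>l = m + 1..n. real c / real b ^ l) < 1 / real b ^ m"
proof -
  show "(\<Sum>l = m + 1..n. real c / real b ^ l) \<ge> 0"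
    by (intro sum_nonneg) simp
  have "(\<Sum>l = m + 1..n. real c / real b ^ l) \<le> 1 / real b ^ m - 1 / real b ^ n"
    using n
  proof (induction n rule: dec_induct)
    case (step n)
    have "real c + 1 \<le> real b" using c by linarith
    then have "real c / real b ^ Suc n \<le> (real b - 1) / real b ^ Suc n"
      by (intro divide_right_mono) auto
    also have "\<dots> = 1 / real b ^ n - 1 / real b ^ Suc n"
      using b by (simp add: field_simps)
    finally show ?case
      using step by simp
  qed simp
  moreover have "1 / real b ^ n > 0" using b by simp
  ultimately show "(\<Sum>l = m + 1..n. real c / real b ^ l) < 1 / real b ^ m" by linarith
qed

lemma ham_x_in_cell:
  assumes b: "b > 0" and n: "m \<le> n" and a: "a \<in> Zb_vectors b (m + 2)"
  shows "real (cell_x b m a) / real b ^ m \<le> ham_x b m n a"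
    and "ham_x b m n a < (real (cell_x b m a) + 1) / real b ^ m"
  using sum_tail_bounds[OF b Zb_vectors_less[OF a, of "m + 1"] n]
    sum_digits_eq_horner[OF b, of "\<lambda>l. (a l + a (m + 1)) mod b" m]
  by (simp_all add: ham_x_def cell_x_def add_divide_distrib)

lemma ham_y_in_cell:
  assumes b: "b > 0" and n: "m \<le> n" and a: "a \<in> Zb_vectors b (m + 2)"
  shows "real (cell_y b m a) / real b ^ m \<le> ham_y b m n a"
    and "ham_y b m n a < (real (cell_y b m a) + 1) / real b ^ m"
proof -
  let ?d = "a (m + 2)"
  have "(\<Sum>l = 1..m. real ((a (m + 1 - l) + ?d) mod b) / real b ^ l) =
      (\<Sum>i = 1..m. real ((a i + ?d) mod b * b ^ (i - 1)) / real b ^ m)"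
  proof (rule sum.reindex_bij_witness[of _ "\<lambda>i. m + 1 - i" "\<lambda>i. m + 1 - i"])
    fix l assume l: "l \<in> {1..m}"
    then have "real b ^ m = real b ^ l * real b ^ (m + 1 - l - 1)"
      by (simp flip: power_add)
    then show "real ((a (m + 1 - l) + ?d) mod b * b ^ (m + 1 - l - 1)) / real b ^ m =
        real ((a (m + 1 - l) + ?d) mod b) / real b ^ l"
      using b by simp
  qed auto
  also have "\<dots> = real (cell_y b m a) / real b ^ m"
    using shifted_reversal_horner[OF b Zb_vectors_less[OF a, of "m + 1"], of ?d m a]
    by (simp add: cell_y_def cell_x_def cell_shift_def sum_divide_distrib)
  finally have "ham_y b m n a =
      real (cell_y b m a) / real b ^ m + (\<Sum>l = m + 1..n. real ?d / real b ^ l)"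
    by (simp add: ham_y_def)
  then show "real (cell_y b m a) / real b ^ m \<le> ham_y b m n a"
    and "ham_y b m n a < (real (cell_y b m a) + 1) / real b ^ m"
    using sum_tail_bounds[OF b Zb_vectors_less[OF a, of "m + 2"] n]
    by (simp_all add: add_divide_distrib)
qed

lemma size_sym_hammersley: "size (sym_hammersley b m n) = b ^ (m + 2)"
  by (simp add: sym_hammersley_def card_Zb_vectors)

text \<open>
  Moving \<open>t\<close> inside its cell affects only points of one column and one row of cells, which contain at
  most \<open>b\<^sup>2\<close> points each, and changes \<open>b ^ (m + 2) * t1 * t2\<close> by at most \<open>2 b\<^sup>2\<close>.  The cells are closed so that they
  cover the whole unit square.
\<close>
lemma local_discrepancy_on_cell:
  assumes b: "b \<ge> 2" and n: "m \<le> n" and A: "A < b ^ m" and B: "B < b ^ m"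
    and t1: "real A / real b ^ m \<le> t1" "t1 \<le> (real A + 1) / real b ^ m"
    and t2: "real B / real b ^ m \<le> t2" "t2 \<le> (real B + 1) / real b ^ m"
  shows "\<bar>local_discrepancy (sym_hammersley b m n) (t1, t2)\<bar>
    \<le> 3 * (real b)\<^sup>2 / real b ^ (m + 2) * (\<bar>compensated_discrepancy b m A B\<bar> + 1)"
proof -
  let ?V = "Zb_vectors b (m + 2)" and ?M = "real b ^ m"
  let ?X = "cell_x b m" and ?Y = "cell_y b m"
  let ?in = "\<lambda>a. ham_x b m n a < t1 \<and> ham_y b m n a < t2"
  define box where "box = (\<Sum>a\<in>?V. of_bool (?X a < A \<and> ?Y a < B) :: real)"
  define count where "count = (\<Sum>a\<in>?V. of_bool (?in a) :: real)"
  have b0: "b > 0" using b by simp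
  have M: "?M > 0" using b0 by simp
  have cell: "real (?X a) \<le> ham_x b m n a * ?M" "ham_x b m n a * ?M < real (?X a) + 1"
    "real (?Y a) \<le> ham_y b m n a * ?M" "ham_y b m n a * ?M < real (?Y a) + 1" if "a \<in> ?V" for a
    using ham_x_in_cell[OF b0 n that] ham_y_in_cell[OF b0 n that] M
    by (simp_all add: field_simps)
  have t: "real A \<le> t1 * ?M" "t1 * ?M \<le> real A + 1" "real B \<le> t2 * ?M" "t2 * ?M \<le> real B + 1"
    using t1 t2 M by (simp_all add: field_simps)
  have lower: "?in a" if "a \<in> ?V" "?X a < A" "?Y a < B" for a
  proof -
    have "ham_x b m n a * ?M < t1 * ?M" "ham_y b m n a * ?M < t2 * ?M"
      using cell[OF that(1)] t that(2,3) by linarith+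
    then show ?thesis using M by simp
  qed
  have upper: "?X a \<le> A \<and> ?Y a \<le> B" if "a \<in> ?V" "?in a" for a
  proof -
    have "ham_x b m n a * ?M < t1 * ?M" "ham_y b m n a * ?M < t2 * ?M"
      using that(2) M by simp_all
    then have "real (?X a) < real A + 1" "real (?Y a) < real B + 1"
      using cell[OF that(1)] t by linarith+
    then show ?thesis by linarith
  qed
  have abscissa: "(\<Sum>a\<in>?V. of_bool (?X a = A) :: real) = (real b)\<^sup>2"
    using sum_over_cells[OF b0, of "\<lambda>X Y. of_bool (X = A)" m] A
    by (simp add: of_bool_def power2_eq_square)
  have ordinate: "(\<Sum>a\<in>?V. of_bool (?Y a = B) :: real) \<le> (real b)\<^sup>2"
  proof -
    have "(\<Sum>X<b ^ m. of_bool (shifted_reversal b e m X = B) :: real) \<le> 1" for e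
    proof -
      let ?S = "{..<b ^ m} \<inter> {X. shifted_reversal b e m X = B}"
      have "(\<Sum>X<b ^ m. of_bool (shifted_reversal b e m X = B) :: real) = real (card ?S)"
        by simp
      moreover have "card ?S \<le> 1"
        using inj_on_shifted_reversal[OF b0, of e m]
        by (subst One_nat_def, subst card_le_Suc0_iff_eq) (auto simp: inj_on_def)
      ultimately show ?thesis by simp
    qed
    then have "(\<Sum>e<b. \<Sum>X<b ^ m. of_bool (shifted_reversal b e m X = B) :: real) \<le> (\<Sum>e<b. 1)"
      by (intro sum_mono)
    then show ?thesis
      using sum_over_cells[OF b0, of "\<lambda>X Y. of_bool (Y = B)" m]
      by (simp add: power2_eq_square mult_left_mono)
  qed
  have "box \<le> count"
    unfolding box_def count_def
  proof (rule sum_mono)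
    fix a assume "a \<in> ?V"
    then show "(of_bool (?X a < A \<and> ?Y a < B) :: real) \<le> of_bool (?in a)"
      using lower[of a] by (cases "?in a") auto
  qed
  moreover have "count \<le> box + 2 * (real b)\<^sup>2"
  proof -
    have "count \<le> (\<Sum>a\<in>?V. of_bool (?X a < A \<and> ?Y a < B)
        + (of_bool (?X a = A) + of_bool (?Y a = B)))"
      unfolding count_def
    proof (rule sum_mono)
      fix a assume "a \<in> ?V"
      then show "(of_bool (?in a) :: real) \<le> of_bool (?X a < A \<and> ?Y a < B)
          + (of_bool (?X a = A) + of_bool (?Y a = B))"
        using upper[of a] by (cases "?in a"; cases "?X a = A"; cases "?Y a = B") auto
    qed
    then show ?thesis
      using abscissa ordinate unfolding box_def sum.distrib by linarith
  qed
  moreover have box: "box = real b * reversal_discrepancy b m A B + (real b)\<^sup>2 * (real A * real B / ?M)"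
  proof -
    have "(\<Sum>X<b ^ m. of_bool (X < A \<and> shifted_reversal b e m X < B) :: real) =
        (\<Sum>X<A. of_bool (shifted_reversal b e m X < B))" for e
      by (rule sum.mono_neutral_cong_right) (use A in auto)
    then have "box = real b * (\<Sum>e<b. \<Sum>X<A. of_bool (shifted_reversal b e m X < B))"
      unfolding box_def using sum_over_cells[OF b0, of "\<lambda>X Y. of_bool (X < A \<and> Y < B)" m] by simp
    then show ?thesis
      by (simp add: reversal_discrepancy_def sum_subtractf algebra_simps power2_eq_square)
  qed
  moreover have "real A * real B / ?M \<le> ?M * (t1 * t2)"
  proof -
    have "real A * real B \<le> (t1 * ?M) * (t2 * ?M)"
      using t by (intro mult_mono) auto
    then show ?thesis using M by (simp add: field_simps)
  qed
  then have "(real b)\<^sup>2 * (real A * real B / ?M) \<le> (real b)\<^sup>2 * (?M * (t1 * t2))"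
    by (intro mult_left_mono) auto
  moreover have "?M * (t1 * t2) \<le> real A * real B / ?M + 2"
  proof -
    have "(t1 * ?M) * (t2 * ?M) \<le> (real A + 1) * (real B + 1)"
      using t by (intro mult_mono) auto
    moreover have "real A + 1 \<le> ?M" "real B + 1 \<le> ?M"
    proof -
      have "real (Suc A) \<le> real (b ^ m)" "real (Suc B) \<le> real (b ^ m)"
        using A B by (simp_all only: of_nat_le_iff Suc_le_eq)
      then show "real A + 1 \<le> ?M" "real B + 1 \<le> ?M" by simp_all
    qed
    ultimately have "(t1 * ?M) * (t2 * ?M) \<le> real A * real B + 2 * ?M"
      by (simp add: algebra_simps)
    then show ?thesis using M by (simp add: field_simps)
  qed
  then have "(real b)\<^sup>2 * (?M * (t1 * t2)) \<le> (real b)\<^sup>2 * (real A * real B / ?M) + 2 * (real b)\<^sup>2"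
    using mult_left_mono[of "?M * (t1 * t2)" "real A * real B / ?M + 2" "(real b)\<^sup>2"]
    by (simp add: algebra_simps)
  ultimately have near: "\<bar>count - (real b)\<^sup>2 * (?M * (t1 * t2)) - real b * reversal_discrepancy b m A B\<bar>
      \<le> 2 * (real b)\<^sup>2"
    by linarith
  have "\<bar>\<Sum>e<b. excess b m A B e\<bar> \<le> (\<Sum>e<b. 1)"
    using abs_excess_le[OF b0 B] by (intro order.trans[OF sum_abs] sum_mono) auto
  then have "\<bar>reversal_discrepancy b m A B\<bar> \<le> \<bar>compensated_discrepancy b m A B\<bar> + real b / 2"
    unfolding compensated_discrepancy_def by simp
  then have "real b * \<bar>reversal_discrepancy b m A B\<bar>
      \<le> real b * (\<bar>compensated_discrepancy b m A B\<bar> + real b / 2)"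
    by (intro mult_left_mono) auto
  also have "\<dots> \<le> (real b)\<^sup>2 * \<bar>compensated_discrepancy b m A B\<bar> + (real b)\<^sup>2"
  proof -
    have "real b * \<bar>compensated_discrepancy b m A B\<bar> \<le> (real b)\<^sup>2 * \<bar>compensated_discrepancy b m A B\<bar>"
      using b by (intro mult_right_mono) (auto simp: power2_eq_square)
    moreover have "real b * (\<bar>compensated_discrepancy b m A B\<bar> + real b / 2) =
        real b * \<bar>compensated_discrepancy b m A B\<bar> + (real b)\<^sup>2 / 2"
      by (simp add: algebra_simps power2_eq_square)
    moreover have "0 \<le> (real b)\<^sup>2" by simp
    ultimately show ?thesis by linarith
  qed
  finally have bound: "\<bar>real b * reversal_discrepancy b m A B\<bar>
      \<le> (real b)\<^sup>2 * \<bar>compensated_discrepancy b m A B\<bar> + (real b)\<^sup>2"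
    by (simp add: abs_mult)
  have nonneg: "0 \<le> (real b)\<^sup>2 * \<bar>compensated_discrepancy b m A B\<bar>" by simp
  have scaled: "\<bar>count - real b ^ (m + 2) * (t1 * t2)\<bar>
      \<le> 3 * (real b)\<^sup>2 * (\<bar>compensated_discrepancy b m A B\<bar> + 1)"
  proof -
    have "real b ^ (m + 2) * (t1 * t2) = (real b)\<^sup>2 * (?M * (t1 * t2))"
      by (simp only: power_add mult_ac)
    moreover have "3 * (real b)\<^sup>2 * (\<bar>compensated_discrepancy b m A B\<bar> + 1) =
        3 * ((real b)\<^sup>2 * \<bar>compensated_discrepancy b m A B\<bar>) + 3 * (real b)\<^sup>2"
      by (simp add: distrib_left)
    ultimately show ?thesis
      using near bound nonneg by linarith
  qed
  have "size (filter_mset (\<lambda>z. z \<in> {0..<t1} \<times> {0..<t2}) (sym_hammersley b m n)) =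
      card {a \<in> ?V. (ham_x b m n a, ham_y b m n a) \<in> {0..<t1} \<times> {0..<t2}}"
    by (simp add: sym_hammersley_def filter_mset_image_mset filter_mset_mset_set finite_Zb_vectors)
  also have "{a \<in> ?V. (ham_x b m n a, ham_y b m n a) \<in> {0..<t1} \<times> {0..<t2}} = {a \<in> ?V. ?in a}"
  proof -
    have "ham_x b m n a \<ge> 0" "ham_y b m n a \<ge> 0" for a
      unfolding ham_x_def ham_y_def by (intro add_nonneg_nonneg sum_nonneg; simp)+
    then show ?thesis by auto
  qed
  finally have "real (size (filter_mset (\<lambda>z. z \<in> {0..<t1} \<times> {0..<t2}) (sym_hammersley b m n))) = count"
    by (simp only: count_def sum_of_bool_eq finite_Zb_vectors Int_def mem_Collect_eq)
  then have "local_discrepancy (sym_hammersley b m n) (t1, t2) =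
      (count - real b ^ (m + 2) * (t1 * t2)) / real b ^ (m + 2)"
    unfolding local_discrepancy_def size_sym_hammersley using b0 by (simp add: diff_divide_distrib)
  then have "\<bar>local_discrepancy (sym_hammersley b m n) (t1, t2)\<bar> =
      \<bar>count - real b ^ (m + 2) * (t1 * t2)\<bar> / real b ^ (m + 2)"
    by simp
  also have "\<dots> \<le> 3 * (real b)\<^sup>2 * (\<bar>compensated_discrepancy b m A B\<bar> + 1) / real b ^ (m + 2)"
    using scaled by (intro divide_right_mono) auto
  finally show ?thesis by simp
qed

section \<open>Integration over the cells\<close>

lemma unit_interval_cell:
  fixes t :: real
  assumes M: "M > 0" and t: "t \<in> {0..1}"
  shows "\<exists>A<M. real A / real M \<le> t \<and> t \<le> (real A + 1) / real M"
proof (cases "t = 1")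
  case True
  then show ?thesis
    using M by (intro exI[of _ "M - 1"]) (auto simp: of_nat_diff)
next
  case False
  define A where "A = nat \<lfloor>t * real M\<rfloor>"
  have A: "real A = of_int \<lfloor>t * real M\<rfloor>"
    using t by (simp add: A_def)
  have "real A \<le> t * real M" "t * real M \<le> real A + 1"
    unfolding A by linarith+
  moreover have "t * real M < real M"
    using t False M by simp
  ultimately have "A < M" "real A \<le> t * real M" "t * real M \<le> real A + 1"
    by linarith+
  then show ?thesis
    using M by (intro exI[of _ A]) (simp add: field_simps)
qed

text \<open>
  The step function \<open>h\<close> is integrable and dominates \<open>f\<close> on the square.  Overlaps of the closed cells
  only increase \<open>h\<close>, on a null set.
\<close>
lemma unit_square_integral_le_cell_average:
  fixes f :: "real \<times> real \<Rightarrow> real"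
  assumes M: "M > 0" and g: "\<And>A B. g A B \<ge> 0"
    and f: "\<And>A B t1 t2. A < M \<Longrightarrow> B < M \<Longrightarrow>
      real A / real M \<le> t1 \<Longrightarrow> t1 \<le> (real A + 1) / real M \<Longrightarrow>
      real B / real M \<le> t2 \<Longrightarrow> t2 \<le> (real B + 1) / real M \<Longrightarrow> f (t1, t2) \<le> g A B"
  shows "(LINT t:{0..1} \<times> {0..1}|lborel. f t) \<le> (\<Sum>A<M. \<Sum>B<M. g A B) / (real M)\<^sup>2"
proof -
  define cell where "cell A B =
    cbox (real A / real M, real B / real M) ((real A + 1) / real M, (real B + 1) / real M)" for A B
  define h where "h t = (\<Sum>A<M. \<Sum>B<M. g A B * indicator (cell A B) t)" for t
  have cell_integrable: "integrable lborel (indicator (cell A B) :: real \<times> real \<Rightarrow> real)" for A B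
    unfolding cell_def
    by (rule integrable_real_indicator[OF _ emeasure_lborel_cbox_finite]) simp
  have cell_integral: "(LINT t|lborel. indicator (cell A B) t) = 1 / (real M)\<^sup>2" for A B
  proof -
    have side: "measure lborel (cbox (real i / real M) ((real i + 1) / real M)) = 1 / real M" for i :: nat
    proof -
      have "real i / real M \<le> (real i + 1) / real M" by (intro divide_right_mono) auto
      then show ?thesis by (simp add: diff_divide_distrib[symmetric])
    qed
    have "(LINT t|lborel. indicator (cell A B) t) = measure lborel (cell A B)"
      by (simp add: cell_def)
    also have "\<dots> = 1 / (real M)\<^sup>2"
      unfolding cell_def content_Pair side by (simp add: power2_eq_square)
    finally show ?thesis .
  qed
  have "indicator ({0..1} \<times> {0..1}) t * f t \<le> h t" for t
  proof (cases "t \<in> {0..1} \<times> {0..1}")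
    case True
    obtain t1 t2 where t: "t = (t1, t2)" by (cases t)
    obtain A where A: "A < M" "real A / real M \<le> t1" "t1 \<le> (real A + 1) / real M"
      using unit_interval_cell[OF M, of t1] True t by auto
    obtain B where B: "B < M" "real B / real M \<le> t2" "t2 \<le> (real B + 1) / real M"
      using unit_interval_cell[OF M, of t2] True t by auto
    have "f t \<le> g A B * indicator (cell A B) t"
      using f[OF A(1) B(1) A(2,3) B(2,3)] A B unfolding t by (simp add: cell_def cbox_Pair_eq)
    also have "\<dots> \<le> (\<Sum>B<M. g A B * indicator (cell A B) t)"
      by (rule member_le_sum) (use B g in auto)
    also have "\<dots> \<le> h t"
      unfolding h_def
      by (rule member_le_sum[of A "{..<M}" "\<lambda>A. \<Sum>B<M. g A B * indicator (cell A B) t"])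
        (use A g in \<open>auto intro!: sum_nonneg\<close>)
    finally show ?thesis using True by simp
  next
    case False
    then show ?thesis using g by (auto simp: h_def intro!: sum_nonneg)
  qed
  moreover have "h t \<ge> 0" for t
    using g by (auto simp: h_def intro!: sum_nonneg)
  moreover have "integrable lborel h"
    unfolding h_def by (intro Bochner_Integration.integrable_sum integrable_mult_right cell_integrable)
  ultimately have "(LINT t:{0..1} \<times> {0..1}|lborel. f t) \<le> (LINT t|lborel. h t)"
    unfolding set_lebesgue_integral_def by (intro integral_mono') auto
  also have "\<dots> = (\<Sum>A<M. \<Sum>B<M. LINT t|lborel. g A B * indicator (cell A B) t)"
    by (simp only: h_def Bochner_Integration.integral_sum Bochner_Integration.integrable_sum
        integrable_mult_right cell_integrable)
  also have "\<dots> = (\<Sum>A<M. \<Sum>B<M. g A B) / (real M)\<^sup>2"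
    by (simp only: integral_mult_right_zero cell_integral sum_divide_distrib
        times_divide_eq_right mult_1_right)
  finally show ?thesis .
qed

text \<open>
  The cell bound is written as \<open>c\<close> times the rescaled martingale plus 1, so that the factor
  \<open>\<surd>(m + 2) / N\<close> with \<open>N = b ^ (m + 2)\<close> sits in
  \<open>c\<close> and the moment bound leaves a constant that depends on \<open>b\<close> and \<open>p\<close> only.
\<close>
lemma Lp_discrepancy_sym_hammersley:
  fixes p :: real
  assumes b: "b \<ge> 2" and n: "m \<le> n" and p: "p \<ge> 1"
  shows "Lp_discrepancy p (sym_hammersley b m n) \<le>
    6 * (real b)\<^sup>2 * p * exp (moment_const b + 1) * (sqrt (real (m + 2)) / real b ^ (m + 2))"
proof -
  let ?P = "sym_hammersley b m n" and ?S = "compensated_discrepancy b m"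
  define s where "s = sqrt (real (m + 2))"
  define c where "c = 3 * (real b)\<^sup>2 / real b ^ (m + 2) * s"
  define E where "E = 2 * exp (moment_const b + 1)"
  have b0: "b > 0" using b by simp
  have s: "s \<ge> 1" by (simp add: s_def)
  have c: "c \<ge> 0" using s by (simp add: c_def)
  have E: "E \<ge> 1"
  proof -
    have "exp (moment_const b + 1) \<ge> 1" by (simp add: moment_const_def)
    then show ?thesis unfolding E_def by linarith
  qed
  have "(LINT t:{0..1} \<times> {0..1}|lborel. \<bar>local_discrepancy ?P t\<bar> powr p)
      \<le> (\<Sum>A<b ^ m. \<Sum>B<b ^ m. c powr p * (\<bar>?S A B\<bar> / s + 1) powr p) / (real (b ^ m))\<^sup>2"
  proof (rule unit_square_integral_le_cell_average)
    fix A B t1 t2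
    assume cell: "A < b ^ m" "B < b ^ m"
      "real A / real (b ^ m) \<le> t1" "t1 \<le> (real A + 1) / real (b ^ m)"
      "real B / real (b ^ m) \<le> t2" "t2 \<le> (real B + 1) / real (b ^ m)"
    have "\<bar>local_discrepancy ?P (t1, t2)\<bar> \<le> 3 * (real b)\<^sup>2 / real b ^ (m + 2) * (\<bar>?S A B\<bar> + 1)"
      using cell by (intro local_discrepancy_on_cell[OF b n]) simp_all
    also have "\<dots> \<le> 3 * (real b)\<^sup>2 / real b ^ (m + 2) * (s * (\<bar>?S A B\<bar> / s + 1))"
      using s by (intro mult_left_mono) (auto simp: field_simps)
    also have "\<dots> = c * (\<bar>?S A B\<bar> / s + 1)"
      by (simp add: c_def)
    finally have "\<bar>local_discrepancy ?P (t1, t2)\<bar> powr p \<le> (c * (\<bar>?S A B\<bar> / s + 1)) powr p"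
      using p by (intro powr_mono2) auto
    also have "\<dots> = c powr p * (\<bar>?S A B\<bar> / s + 1) powr p"
      using c s by (simp add: powr_mult)
    finally show "\<bar>local_discrepancy ?P (t1, t2)\<bar> powr p \<le> c powr p * (\<bar>?S A B\<bar> / s + 1) powr p" .
  qed (use b0 in auto)
  also have "\<dots> = c powr p * (\<Sum>A<b ^ m. \<Sum>B<b ^ m. (\<bar>?S A B\<bar> / s + 1) powr p) / real b ^ (2 * m)"
    by (simp add: sum_distrib_left power_mult[symmetric] mult.commute[of m])
  also have "\<dots> \<le> c powr p * (real b ^ (2 * m) * (p powr p * E)) / real b ^ (2 * m)"
    using compensated_discrepancy_moment[OF b0, of p m] p unfolding s_def E_def
    by (intro divide_right_mono mult_left_mono) auto
  also have "\<dots> = (c * p) powr p * E"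
    using b0 c p by (simp add: powr_mult)
  finally have bound: "(LINT t:{0..1} \<times> {0..1}|lborel. \<bar>local_discrepancy ?P t\<bar> powr p)
      \<le> (c * p) powr p * E" .
  have nonneg: "0 \<le> (LINT t:{0..1} \<times> {0..1}|lborel. \<bar>local_discrepancy ?P t\<bar> powr p)"
    unfolding set_lebesgue_integral_def by (intro Bochner_Integration.integral_nonneg) auto
  have "Lp_discrepancy p ?P \<le> ((c * p) powr p * E) powr (1 / p)"
    unfolding Lp_discrepancy_def using bound nonneg p by (intro powr_mono2) auto
  also have "\<dots> = c * p * E powr (1 / p)"
    using c p E by (simp add: powr_mult powr_powr)
  also have "\<dots> \<le> c * p * E powr 1"
    using c p E by (intro mult_left_mono powr_mono) auto
  also have "\<dots> = 6 * (real b)\<^sup>2 * p * exp (moment_const b + 1) * (sqrt (real (m + 2)) / real b ^ (m + 2))"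
    using E by (simp add: c_def s_def E_def)
  finally show ?thesis .
qed

theorem proposition29:
  fixes b :: nat
  assumes "prime b"
  shows "(\<forall>m n :: nat. m \<ge> 1 \<and> n > 2 * m \<longrightarrow>
            size (sym_hammersley b m n) = b ^ (m + 2) \<and>
            min_dick_weight b (m + 2) (ham_C1 m n) (ham_C2 m n) > 2 * m + 1)
    \<and> (\<forall>p :: real. p \<ge> 1 \<longrightarrow> (\<exists>C :: real. C > 0 \<and>
          (\<forall>m n N :: nat. m \<ge> 1 \<and> n > 2 * m \<and> N = b ^ (m + 2) \<longrightarrow>
            Lp_discrepancy p (sym_hammersley b m n) \<le> C * (sqrt (real (m + 2)) / real b ^ (m + 2)) \<and>
            sqrt (real (m + 2)) / real b ^ (m + 2) = sqrt (log (real b) (real N)) / real N)))"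
proof (intro conjI allI impI)
  have b: "b \<ge> 2" using assms by (rule prime_ge_2_nat)
  show "size (sym_hammersley b m n) = b ^ (m + 2)" for m n
    by (rule size_sym_hammersley)
  show "min_dick_weight b (m + 2) (ham_C1 m n) (ham_C2 m n) > 2 * m + 1"
    if "m \<ge> 1 \<and> n > 2 * m" for m n
    using that ham_min_dick_weight[OF b] by blast
  fix p :: real assume p: "p \<ge> 1"
  define C where "C = 6 * (real b)\<^sup>2 * p * exp (moment_const b + 1)"
  have "C > 0" using b p by (simp add: C_def)
  moreover have "Lp_discrepancy p (sym_hammersley b m n) \<le> C * (sqrt (real (m + 2)) / real b ^ (m + 2)) \<and>
      sqrt (real (m + 2)) / real b ^ (m + 2) = sqrt (log (real b) (real N)) / real N"
    if "m \<ge> 1 \<and> n > 2 * m \<and> N = b ^ (m + 2)" for m n N :: nat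
  proof
    show "Lp_discrepancy p (sym_hammersley b m n) \<le> C * (sqrt (real (m + 2)) / real b ^ (m + 2))"
      unfolding C_def using that p by (intro Lp_discrepancy_sym_hammersley[OF b]) auto
    have "log (real b) (real N) = real (m + 2)"
      using that b log_pow_cancel[of "real b" "m + 2"] by simp
    then show "sqrt (real (m + 2)) / real b ^ (m + 2) = sqrt (log (real b) (real N)) / real N"
      using that by simp
  qed
  ultimately show "\<exists>C :: real. C > 0 \<and>
      (\<forall>m n N :: nat. m \<ge> 1 \<and> n > 2 * m \<and> N = b ^ (m + 2) \<longrightarrow>
        Lp_discrepancy p (sym_hammersley b m n) \<le> C * (sqrt (real (m + 2)) / real b ^ (m + 2)) \<and>
        sqrt (real (m + 2)) / real b ^ (m + 2) = sqrt (log (real b) (real N)) / real N)"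
    by blast
qed

end
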